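(* Fix $P\in\mathrm{Gr}(k,n)$. The fiber $M_P(n,k)=\pi_M^{-1}(P)$ is totally geodesic in $(M(n,k),h)$.
   Context: Notation: $\mathrm{Gr}(k,n)$ is the Grassmannian of $k$-dimensional subspaces of $\mathbb{R}^n$; $\mathrm{St}(n,k)$ the Stiefel manifold of real $n\times k$ matrices with orthonormal columns; $\mathrm{Sym}^+(k)$ the symmetric positive definite $k\times k$ matrices; $\mathrm{Sym}^+(n,k)=\{\Sigma\in\mathrm{Sym}(n):\Sigma\succeq0,\ \mathrm{rk}(\Sigma)=k\}$, a smooth submanifold of the space $\mathrm{Sym}(n)$ of symmetric $n\times n$ matrices. For $A\in\mathrm{Sym}^+(k)$ and $B$ symmetric, $\mathcal{S}_A(B)$ is the unique solution $C$ of $AC+CA=B$. For $\Sigma\in\mathrm{Sym}^+(n,k)$ let $P_\Sigma^\perp$ be the orthogonal projector onto the nullspace of $\Sigma$ and $\Sigma^\dagger$ the Moore--Penrose inverse; $T_\Sigma\mathrm{Sym}^+(n,k)=\{V\in\mathrm{Sym}(n):P_\Sigma^\perp VP_\Sigma^\perp=0\}$. Writing $\Sigma=QDQ^\top$ with $Q\in\mathrm{St}(n,k)$ and $D$ positive definite (diagonal), put $\mathtt{S}_{\Sigma,V}=Q\,\mathcal{S}_D(Q^\top VQ)\,Q^\top$ (independent of the decomposition). The Bures--Wasserstein metric is $$g_\Sigma^{BW(n,k)}(V,W)=\mathrm{Tr}(\mathtt{S}_{\Sigma,V}\,\Sigma\,\mathtt{S}_{\Sigma,W})+\mathrm{Tr}(P_\Sigma^\perp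 V\Sigma^\dagger W).$$ $M(n,k)=\big(\mathrm{St}(n,k)\times\mathrm{Sym}^+(k)\big)/O(k)$ is the quotient manifold by the free proper right action $(Q,D)\cdot G=(QG,G^\top DG)$, with classes $[Q,D]$; $\phi:M(n,k)\to\mathrm{Sym}^+(n,k)$, $\phi([Q,D])=QDQ^\top$, is a diffeomorphism, and $h=\phi^*g^{BW(n,k)}$ is the pullback metric. The bundle projection is $\pi_M:M(n,k)\to\mathrm{Gr}(k,n)$, $\pi_M([Q,D])=\mathrm{Span}(Q)$. A submanifold is totally geodesic if every geodesic of the ambient manifold starting at a point of the submanifold with initial velocity tangent to it remains in the submanifold as long as it is defined (here the fibers are closed submanifolds). *)

theory Defs
  imports "HOL-Analysis.Analysis"
begin

section \<open>Smooth maps and geodesics in local coordinates\<close>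

text \<open>For open \<open>S\<close> in a Euclidean space this is class \<open>C\<^sup>m\<close>: all iterated directional
  derivatives up to order \<open>m\<close> exist and are continuous.\<close>

primrec cont_diff_on :: "nat \<Rightarrow> 'a::euclidean_space set \<Rightarrow> ('a \<Rightarrow> 'b::real_normed_vector) \<Rightarrow> bool"
where
  "cont_diff_on 0 S f \<longleftrightarrow> continuous_on S f"
| "cont_diff_on (Suc m) S f \<longleftrightarrow>
     (\<forall>x\<in>S. f differentiable (at x)) \<and>
     (\<forall>v. cont_diff_on m S (\<lambda>x. frechet_derivative f (at x) v))"

definition smooth_on :: "'a::euclidean_space set \<Rightarrow> ('a \<Rightarrow> 'b::real_normed_vector) \<Rightarrow> bool" where
  "smooth_on S f \<longleftrightarrow> (\<forall>m. cont_diff_on m S f)"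

definition partial :: "'d \<Rightarrow> (real^'d \<Rightarrow> 'b::real_normed_vector) \<Rightarrow> real^'d \<Rightarrow> 'b" where
  "partial i f u = frechet_derivative f (at u) (axis i 1)"

text \<open>Christoffel symbols of the Levi-Civita connection; \<open>christoffel G u l i j\<close> has
  upper index \<open>l\<close>.\<close>

definition christoffel :: "(real^'d \<Rightarrow> real^'d^'d) \<Rightarrow> real^'d \<Rightarrow> 'd \<Rightarrow> 'd \<Rightarrow> 'd \<Rightarrow> real" where
  "christoffel G u l i j =
     (1/2) * (\<Sum>m\<in>UNIV. matrix_inv (G u) $ l $ m *
       (partial i (\<lambda>x. G x $ j $ m) u + partial j (\<lambda>x. G x $ i $ m) u
        - partial m (\<lambda>x. G x $ i $ j) u))"

text \<open>A manifold with point type \<open>'p\<close> is presented by the set of its local parametrizations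
  \<open>(U, \<psi>)\<close>, the inverses \<open>\<psi> : U \<rightarrow> M\<close> of its smooth charts, and a Riemannian
  metric by its coefficient matrix \<open>h \<psi> u\<close> in each of them.  Since the geodesic equation and
  the tangency of a velocity do not depend on the parametrization, they are required in
  some parametrization around the point in question.\<close>

type_synonym ('d, 'p) parametrization = "(real^'d) set \<times> (real^'d \<Rightarrow> 'p)"
type_synonym ('d, 'p) metric_coeffs = "(real^'d \<Rightarrow> 'p) \<Rightarrow> real^'d \<Rightarrow> real^'d^'d"

definition geodesic ::
  "('d::finite, 'p) parametrization set \<Rightarrow> ('d::finite, 'p) metric_coeffs \<Rightarrow> real set \<Rightarrow> (real \<Rightarrow> 'p) \<Rightarrow> bool"
where
  "geodesic \<A> h I \<gamma> \<longleftrightarrow>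
     open I \<and> is_interval I \<and>
     (\<forall>t\<in>I. \<exists>(U, \<psi>)\<in>\<A>. \<exists>J x x'. open J \<and> t \<in> J \<and> J \<subseteq> I \<and>
        (\<forall>s\<in>J. x s \<in> U \<and> \<gamma> s = \<psi> (x s) \<and>
           (x has_vector_derivative x' s) (at s) \<and>
           (x' has_vector_derivative
              (\<chi> l. - (\<Sum>i\<in>UNIV. \<Sum>j\<in>UNIV. christoffel (h \<psi>) (x s) l i j * x' s $ i * x' s $ j)))
             (at s)))"

text \<open>Coordinate expression, at the point \<open>\<psi> x\<^sub>0\<close>, of the tangent space of a submanifold \<open>N\<close>: the
  velocities of the smooth curves lying in \<open>N\<close>.\<close>

definition coord_tangent_space ::
  "('d::finite, 'p) parametrization \<Rightarrow> 'p set \<Rightarrow> real^'d \<Rightarrow> (real^'d) set"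
where
  "coord_tangent_space = (\<lambda>(U, \<psi>) N x\<^sub>0.
     {y. \<exists>J c. open J \<and> 0 \<in> J \<and> smooth_on J c \<and> (\<forall>s\<in>J. c s \<in> U \<and> \<psi> (c s) \<in> N) \<and>
           c 0 = x\<^sub>0 \<and> (c has_vector_derivative y) (at (0::real))})"

definition initial_velocity_tangent ::
  "('d::finite, 'p) parametrization set \<Rightarrow> 'p set \<Rightarrow> (real \<Rightarrow> 'p) \<Rightarrow> bool"
where
  "initial_velocity_tangent \<A> N \<gamma> \<longleftrightarrow>
     (\<exists>(U, \<psi>)\<in>\<A>. \<exists>J x. open J \<and> 0 \<in> J \<and> (\<forall>s\<in>J. x s \<in> U \<and> \<gamma> s = \<psi> (x s)) \<and>
        (\<exists>y\<in>coord_tangent_space (U, \<psi>) N (x 0). (x has_vector_derivative y) (at 0)))"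

definition totally_geodesic ::
  "('d::finite, 'p) parametrization set \<Rightarrow> ('d::finite, 'p) metric_coeffs \<Rightarrow> 'p set \<Rightarrow> bool"
where
  "totally_geodesic \<A> h N \<longleftrightarrow>
     (\<forall>I \<gamma>. geodesic \<A> h I \<gamma> \<and> 0 \<in> I \<and> \<gamma> 0 \<in> N \<and> initial_velocity_tangent \<A> N \<gamma>
        \<longrightarrow> (\<forall>t\<in>I. \<gamma> t \<in> N))"

section \<open>The Bures--Wasserstein metric\<close>

definition stiefel :: "(real^'k^'n) set" where
  "stiefel = {Q. transpose Q ** Q = mat 1}"

definition sym_pos :: "(real^'k^'k) set" where
  "sym_pos = {A. transpose A = A \<and> (\<forall>x. x \<noteq> 0 \<longrightarrow> x \<bullet> (A *v x) > 0)}"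

definition grassmannian :: "nat \<Rightarrow> (real^'n) set set" where
  "grassmannian k = {P. subspace P \<and> dim P = k}"

definition sylvester :: "real^'k^'k \<Rightarrow> real^'k^'k \<Rightarrow> real^'k^'k" where
  "sylvester A B = (THE C. A ** C + C ** A = B)"

definition null_projector :: "real^'n^'n \<Rightarrow> real^'n^'n" where
  "null_projector \<Sigma> =
     (THE R. transpose R = R \<and> R ** R = R \<and> range (\<lambda>x. R *v x) = {x. \<Sigma> *v x = 0})"

definition pseudo_inverse :: "real^'n^'m \<Rightarrow> real^'m^'n" where
  "pseudo_inverse A =
     (THE X. A ** X ** A = A \<and> X ** A ** X = X \<and>
        transpose (A ** X) = A ** X \<and> transpose (X ** A) = X ** A)"

text \<open>The matrix does not depend on the decomposition \<open>\<Sigma> = Q D Q\<^sup>T\<close>, so \<open>D\<close> may be any positive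
  definite matrix, not only a diagonal one.  The type argument fixes the rank \<open>k\<close>.\<close>

definition bw_S :: "'k::finite itself \<Rightarrow> real^'n^'n \<Rightarrow> real^'n^'n \<Rightarrow> real^'n^'n" where
  "bw_S _ \<Sigma> V =
     (THE S. \<exists>Q\<in>(stiefel :: (real^'k^'n) set). \<exists>D\<in>sym_pos. \<Sigma> = Q ** D ** transpose Q \<and>
        S = Q ** sylvester D (transpose Q ** V ** Q) ** transpose Q)"

definition bw_metric :: "'k::finite itself \<Rightarrow> real^'n^'n \<Rightarrow> real^'n^'n \<Rightarrow> real^'n^'n \<Rightarrow> real" where
  "bw_metric k \<Sigma> V W =
     trace (bw_S k \<Sigma> V ** \<Sigma> ** bw_S k \<Sigma> W)
     + trace (null_projector \<Sigma> ** V ** pseudo_inverse \<Sigma> ** W)"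

section \<open>The quotient manifold\<close>

type_synonym ('n, 'k) pairs = "(real^'k^'n) \<times> (real^'k^'k)"

definition orbit_rel :: "(('n::finite, 'k::finite) pairs \<times> ('n::finite, 'k::finite) pairs) set" where
  "orbit_rel = {((Q, D), (Q', D')). (Q, D) \<in> stiefel \<times> sym_pos \<and>
     (\<exists>G. orthogonal_matrix G \<and> Q' = Q ** G \<and> D' = transpose G ** D ** G)}"

definition quot_class :: "('n::finite, 'k::finite) pairs \<Rightarrow> ('n::finite, 'k::finite) pairs set" where
  "quot_class p = orbit_rel `` {p}"

definition quot_M :: "('n::finite, 'k::finite) pairs set set" where
  "quot_M = (stiefel \<times> sym_pos) // orbit_rel"

definition phi :: "('n::finite, 'k::finite) pairs set \<Rightarrow> real^'n^'n" where
  "phi m = the_elem ((\<lambda>(Q, D). Q ** D ** transpose Q) ` m)"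

definition pi_M :: "('n::finite, 'k::finite) pairs set \<Rightarrow> (real^'n) set" where
  "pi_M m = the_elem ((\<lambda>(Q, D). span (columns Q)) ` m)"

definition fiber :: "(real^'n) set \<Rightarrow> ('n::finite, 'k::finite) pairs set set" where
  "fiber P = {m \<in> quot_M. pi_M m = P}"

text \<open>Index type of the local coordinates.  For \<open>k \<le> n\<close> the manifold has dimension
  \<open>dim St(n,k) + dim Sym(k) - dim O(k) = k (n - k) + k (k + 1) / 2\<close>.\<close>

typedef ('n::finite, 'k::finite) coord =
  "{i::nat. i < CARD('k) * (CARD('n) - CARD('k)) + CARD('k) * (CARD('k) + 1) div 2}"
proof
  have "0 < CARD('k)"
    by simp
  then have "2 \<le> CARD('k) * (CARD('k) + 1)"
    by (cases "CARD('k)") auto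
  then show "0 \<in> {i::nat. i < CARD('k) * (CARD('n) - CARD('k)) + CARD('k) * (CARD('k) + 1) div 2}"
    by simp
qed

instance coord :: (finite, finite) finite
proof
  have "(UNIV :: ('a, 'b) coord set) = Abs_coord `
      {i. i < CARD('b) * (CARD('a) - CARD('b)) + CARD('b) * (CARD('b) + 1) div 2}"
    using type_definition.Abs_image[OF type_definition_coord] by metis
  then show "finite (UNIV :: ('a, 'b) coord set)"
    by (metis finite_Collect_less_nat finite_imageI)
qed

text \<open>Tangent space at \<open>(Q, D)\<close> of its orbit: the derivatives at \<open>0\<close> of
  \<open>(Q exp (tA), exp (- tA) D exp (tA))\<close> for skew-symmetric \<open>A\<close>.\<close>

definition vertical :: "('n::finite, 'k::finite) pairs \<Rightarrow> ('n::finite, 'k::finite) pairs set" where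
  "vertical = (\<lambda>(Q, D). {(Q ** A, D ** A - A ** D) | A. transpose A = - A})"

text \<open>The smooth structure of the quotient is the one for which
  \<open>quot_class\<close> is a submersion.  Hence a map into the quotient is smooth iff it locally lifts to a
  smooth map into \<open>St(n,k) \<times> Sym\<^sup>+(k)\<close>, and it is an immersion iff the derivative of a
  lift sends only \<open>0\<close> into the vertical space.  As the coordinate space has the
  dimension of the quotient, an injective immersion of an open set is a diffeomorphism onto an
  open subset.\<close>

definition quot_params :: "(('n::finite, 'k::finite) coord, ('n::finite, 'k::finite) pairs set) parametrization set" where
  "quot_params = {(U, \<psi>). open U \<and> inj_on \<psi> U \<and> \<psi> ` U \<subseteq> quot_M \<and>
     (\<forall>u\<in>U. \<exists>N \<sigma>. open N \<and> u \<in> N \<and> N \<subseteq> U \<and> smooth_on N \<sigma> \<and>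
        \<sigma> ` N \<subseteq> stiefel \<times> sym_pos \<and> (\<forall>x\<in>N. \<psi> x = quot_class (\<sigma> x)) \<and>
        (\<forall>x\<in>N. \<forall>v. frechet_derivative \<sigma> (at x) v \<in> vertical (\<sigma> x) \<longrightarrow> v = 0))}"

text \<open>Coordinate coefficients of the pullback of the Bures--Wasserstein metric along \<open>phi\<close>.\<close>

definition metric_h :: "(('n::finite, 'k::finite) coord, ('n::finite, 'k::finite) pairs set) metric_coeffs" where
  "metric_h \<psi> u =
     (\<chi> i j. bw_metric TYPE('k) (phi (\<psi> u)) (partial i (phi \<circ> \<psi>) u) (partial j (phi \<circ> \<psi>) u))"

end

theory Submission
  imports Defs
begin

text \<open>Along a geodesic \<open>\<gamma>\<close> put \<open>\<Sigma> = phi \<gamma>\<close>.  The Bures--Wasserstein metric is the quotient, under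
  \<open>X \<mapsto> X X\<^sup>T\<close>, of the Euclidean metric on matrices of full column rank.  The horizontal lift of a
  tangent vector \<open>V\<close> is \<open>S X\<close>, where \<open>S\<close> is symmetric with \<open>S \<Sigma> + \<Sigma> S = V\<close>, and
  \<open>g(V, W) = Tr (S\<^sub>V \<Sigma> S\<^sub>W)\<close> (\<open>bw_metric_eq_inner\<close>).  Hence geodesics are images of straight lines
  \<open>X + t S X\<close>, so that \<open>\<Sigma>(t) = \<Sigma> + t V + t\<^sup>2 S \<Sigma> S\<close> is a quadratic polynomial.

  In coordinates this comes out as follows.  The Christoffel form of the geodesic equation is the
  Euler--Lagrange equation of the energy (\<open>euler_lagrange\<close>).  Differentiating
  \<open>S \<Sigma> + \<Sigma> S = V\<close> eliminates \<open>\<partial>S\<close> from the derivative of the energy, and what remains says that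
  \<open>S' + S\<^sup>2\<close> is orthogonal to all coordinate vectors.  These span the tangent space, by a dimension
  count (\<open>dim_tangent_le\<close>), which forces \<open>(S' + S\<^sup>2) \<Sigma> = 0\<close> (\<open>riccati\<close>).  It follows that
  \<open>\<Sigma>'' = 2 S \<Sigma> S\<close> and \<open>(S \<Sigma> S)' = 0\<close>.  As \<open>\<Sigma>\<close> does not depend on the parametrization, the local
  statements give the formula on the whole interval (\<open>geodesic_quadratic\<close>).

  The fiber over \<open>P\<close> consists of the points with \<open>\<Sigma> w = 0\<close> for every \<open>w\<close> orthogonal to \<open>P\<close>
  (\<open>fiber_iff_annihilated\<close>), and a velocity tangent to the fiber satisfies \<open>V w = 0\<close> as well.  Then
  \<open>\<Sigma> S w = V w - S \<Sigma> w = 0\<close>, all three coefficients of the polynomial annihilate \<open>w\<close>, and the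
  geodesic stays in the fiber.\<close>

section \<open>Matrix algebra with the Frobenius inner product\<close>

lemma bounded_bilinear_matrix_mult:
  "bounded_bilinear (\<lambda>(A::real^'m^'n) (B::real^'l^'m). A ** B)"
  by (auto simp flip: bilinear_conv_bounded_bilinear
      simp: bilinear_def intro!: linearI)
    (simp_all add: matrix_matrix_mult_def vec_eq_iff algebra_simps sum.distrib sum_distrib_left)

lemmas matrix_mult_simps =
  bounded_bilinear.add_left[OF bounded_bilinear_matrix_mult]
  bounded_bilinear.add_right[OF bounded_bilinear_matrix_mult]
  bounded_bilinear.diff_left[OF bounded_bilinear_matrix_mult]
  bounded_bilinear.diff_right[OF bounded_bilinear_matrix_mult]
  bounded_bilinear.minus_left[OF bounded_bilinear_matrix_mult]
  bounded_bilinear.minus_right[OF bounded_bilinear_matrix_mult]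
  bounded_bilinear.zero_left[OF bounded_bilinear_matrix_mult]
  bounded_bilinear.zero_right[OF bounded_bilinear_matrix_mult]
  bounded_bilinear.scaleR_left[OF bounded_bilinear_matrix_mult]
  bounded_bilinear.scaleR_right[OF bounded_bilinear_matrix_mult]
  bounded_bilinear.sum_left[OF bounded_bilinear_matrix_mult]
  bounded_bilinear.sum_right[OF bounded_bilinear_matrix_mult]

lemma bounded_linear_transpose: "bounded_linear (transpose :: real^'m^'n \<Rightarrow> real^'n^'m)"
  by (auto simp flip: linear_conv_bounded_linear intro!: linearI
      simp: transpose_def vec_eq_iff)

lemmas transpose_simps =
  linear_add[OF bounded_linear.linear[OF bounded_linear_transpose]]
  linear_diff[OF bounded_linear.linear[OF bounded_linear_transpose]]
  linear_neg[OF bounded_linear.linear[OF bounded_linear_transpose]]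
  linear_0[OF bounded_linear.linear[OF bounded_linear_transpose]]
  linear_cmul[OF bounded_linear.linear[OF bounded_linear_transpose]]
  linear_sum[OF bounded_linear.linear[OF bounded_linear_transpose]]
  matrix_transpose_mul

lemma bounded_bilinear_matrix_vector_mult:
  "bounded_bilinear (\<lambda>(A::real^'m^'n) (x::real^'m). A *v x)"
  by (auto simp flip: bilinear_conv_bounded_bilinear
      simp: bilinear_def intro!: linearI)
    (simp_all add: algebra_simps scaleR_matrix_vector_assoc)

lemma trace_eq_inner: "trace (A ** B) = transpose A \<bullet> B" for A :: "real^'m^'n"
  by (subst trace_mul_sym)
    (simp add: trace_def matrix_matrix_mult_def transpose_def inner_vec_def mult.commute)

lemma inner_transpose: "transpose A \<bullet> transpose B = A \<bullet> B" for A :: "real^'m^'n"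
  by (simp add: transpose_def inner_vec_def) (rule sum.swap)

lemma inner_matrix_mult_left: "(A ** B) \<bullet> C = B \<bullet> (transpose A ** C)"
  for A :: "real^'m^'n" and B :: "real^'l^'m"
proof -
  have "(A ** B) \<bullet> C = trace (transpose (A ** B) ** C)"
    by (simp only: trace_eq_inner transpose_transpose)
  also have "\<dots> = trace (transpose B ** (transpose A ** C))"
    by (simp only: matrix_transpose_mul matrix_mul_assoc)
  also have "\<dots> = B \<bullet> (transpose A ** C)"
    by (simp only: trace_eq_inner transpose_transpose)
  finally show ?thesis .
qed

lemma inner_matrix_mult_right: "(A ** B) \<bullet> C = A \<bullet> (C ** transpose B)"
  for A :: "real^'m^'n" and B :: "real^'l^'m"
proof -
  have "(A ** B) \<bullet> C = (transpose B ** transpose A) \<bullet> transpose C"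
    by (simp only: inner_transpose flip: matrix_transpose_mul)
  also have "\<dots> = transpose A \<bullet> transpose (C ** transpose B)"
    by (simp only: inner_matrix_mult_left matrix_transpose_mul transpose_transpose)
  finally show ?thesis
    by (simp only: inner_transpose)
qed

text \<open>The row vectors of \<open>X\<close> contribute \<open>x \<bullet> D x\<close> each.\<close>

lemma inner_mult_pos_definite:
  fixes X :: "real^'k^'n" and D :: "real^'k^'k"
  assumes pos: "\<And>x. x \<noteq> 0 \<Longrightarrow> 0 < x \<bullet> (D *v x)"
  shows "0 \<le> X \<bullet> (X ** D)" and "X \<bullet> (X ** D) = 0 \<Longrightarrow> X = 0"
proof -
  have row: "(X ** D) $ i = transpose D *v X $ i" for i
    by (simp add: matrix_matrix_mult_def vector_matrix_mult_def vec_eq_iff mult.commute)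
  have "x \<bullet> (transpose D *v x) = x \<bullet> (D *v x)" for x
    by (metis dot_lmul_matrix inner_commute transpose_matrix_vector)
  then have eq: "X \<bullet> (X ** D) = (\<Sum>i\<in>UNIV. X $ i \<bullet> (D *v X $ i))"
    by (simp add: inner_vec_def[of X] row del: transpose_matrix_vector)
  have nonneg: "0 \<le> X $ i \<bullet> (D *v X $ i)" for i
    using pos[of "X $ i"] by (cases "X $ i = 0") auto
  show "0 \<le> X \<bullet> (X ** D)"
    unfolding eq by (intro sum_nonneg nonneg)
  assume "X \<bullet> (X ** D) = 0"
  then have "\<forall>i. X $ i \<bullet> (D *v X $ i) = 0"
    unfolding eq using sum_nonneg_eq_0_iff[of UNIV "\<lambda>i. X $ i \<bullet> (D *v X $ i)"] nonneg by simp
  then show "X = 0"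
    using pos by (metis less_irrefl vec_eq_iff zero_index)
qed

lemma sym_posD: "D \<in> sym_pos \<Longrightarrow> transpose D = D"
  "D \<in> sym_pos \<Longrightarrow> x \<noteq> 0 \<Longrightarrow> 0 < x \<bullet> (D *v x)"
  by (auto simp: sym_pos_def)

lemma sym_pos_inverse:
  assumes "D \<in> sym_pos"
  obtains E where "D ** E = mat 1" "E ** D = mat 1" "transpose E = E"
proof -
  have "\<forall>x. D *v x = 0 \<longrightarrow> x = 0"
    using sym_posD(2)[OF assms] by (metis inner_zero_right less_irrefl)
  then obtain E where E: "E ** D = mat 1"
    by (metis matrix_left_invertible_ker)
  then have E': "D ** E = mat 1"
    using matrix_left_right_inverse by blast
  have "transpose E = (transpose E ** D) ** E"
    by (simp add: E' matrix_mul_assoc[symmetric])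
  also have "transpose E ** D = transpose (D ** E)"
    using sym_posD(1)[OF assms] by (simp add: matrix_transpose_mul)
  also have "transpose (D ** E) ** E = E"
    by (simp add: E')
  finally show thesis
    using E E' that by blast
qed

section \<open>The Sylvester equation\<close>

text \<open>Pairing \<open>D C + C D = 0\<close> with \<open>C\<close> gives a sum of two nonnegative terms, one for the rows and one
  for the columns of \<open>C\<close>; it vanishes only for \<open>C = 0\<close>.\<close>

lemma sylvester_injective:
  fixes D :: "real^'k^'k"
  assumes pos: "\<And>x. x \<noteq> 0 \<Longrightarrow> 0 < x \<bullet> (D *v x)" and eq: "D ** C + C ** D = 0"
  shows "C = 0"
proof -
  have pos': "0 < x \<bullet> (transpose D *v x)" if "x \<noteq> 0" for x
    by (metis dot_lmul_matrix inner_commute transpose_matrix_vector pos that)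
  have "0 = C \<bullet> (D ** C + C ** D)"
    by (simp add: eq)
  also have "\<dots> = transpose C \<bullet> (transpose C ** transpose D) + C \<bullet> (C ** D)"
    by (metis inner_add_right inner_transpose matrix_transpose_mul)
  finally show ?thesis
    using inner_mult_pos_definite[OF pos, of C] inner_mult_pos_definite[OF pos', of "transpose C"]
    by simp
qed

lemma sylvester_ex1:
  fixes D :: "real^'k^'k"
  assumes pos: "\<And>x. x \<noteq> 0 \<Longrightarrow> 0 < x \<bullet> (D *v x)"
  shows "\<exists>!C. D ** C + C ** D = B"
proof -
  have lin: "linear (\<lambda>C. D ** C + C ** D)"
    by (intro linearI) (simp_all add: matrix_mult_simps algebra_simps)
  have "inj (\<lambda>C. D ** C + C ** D)"
    unfolding linear_injective_0[OF lin] using sylvester_injective[OF pos] by blast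
  then have "bij (\<lambda>C. D ** C + C ** D)"
    using linear_injective_imp_surjective[OF lin] by (simp add: bij_def)
  then show ?thesis
    unfolding bij_iff by blast
qed

lemma sylvester_solves:
  assumes "\<And>x. x \<noteq> 0 \<Longrightarrow> 0 < x \<bullet> (D *v x)"
  shows "D ** sylvester D B + sylvester D B ** D = B"
  unfolding sylvester_def by (rule theI'[OF sylvester_ex1[OF assms]])

lemma sylvester_unique:
  assumes "\<And>x. x \<noteq> 0 \<Longrightarrow> 0 < x \<bullet> (D *v x)" and "D ** C + C ** D = B"
  shows "sylvester D B = C"
  unfolding sylvester_def by (rule the1_equality[OF sylvester_ex1[OF assms(1)] assms(2)])

lemma linear_sylvester:
  assumes "\<And>x. x \<noteq> 0 \<Longrightarrow> 0 < x \<bullet> (D *v x)"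
  shows "linear (sylvester D)"
proof (rule linearI)
  show "sylvester D (A + B) = sylvester D A + sylvester D B" for A B
    by (rule sylvester_unique[OF assms])
      (use sylvester_solves[OF assms, of A] sylvester_solves[OF assms, of B]
        in \<open>auto simp: matrix_mult_simps algebra_simps\<close>)
  show "sylvester D (c *\<^sub>R B) = c *\<^sub>R sylvester D B" for c B
    by (rule sylvester_unique[OF assms])
      (use sylvester_solves[OF assms, of B]
        in \<open>auto simp: matrix_mult_simps simp flip: scaleR_add_right\<close>)
qed

text \<open>The transpose of a solution solves the transposed equation, so it is the same solution.\<close>

lemma transpose_sylvester:
  assumes "D \<in> sym_pos" and "transpose B = B"
  shows "transpose (sylvester D B) = sylvester D B"
proof (rule sylvester_unique[OF sym_posD(2)[OF assms(1)], symmetric])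
  have "transpose (D ** sylvester D B + sylvester D B ** D) = B"
    by (subst sylvester_solves[OF sym_posD(2)[OF assms(1)]]) (use assms in auto)
  then show "D ** transpose (sylvester D B) + transpose (sylvester D B) ** D = B"
    using sym_posD(1)[OF assms(1)] by (simp add: transpose_simps add.commute)
qed

lemma norm_matrix_vector_mult_le:
  "norm (A *v x) \<le> norm A * norm x" for A :: "real^'m^'n"
proof -
  have "norm (A *v x) = L2_set (\<lambda>i. \<bar>A $ i \<bullet> x\<bar>) UNIV"
    by (simp add: norm_vec_def matrix_vector_mul_component)
  also have "\<dots> \<le> L2_set (\<lambda>i. norm (A $ i) * norm x) UNIV"
    by (intro L2_set_mono) (auto simp: Cauchy_Schwarz_ineq2)
  also have "\<dots> = norm A * norm x"
    by (simp add: norm_vec_def L2_set_left_distrib)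
  finally show ?thesis .
qed

text \<open>The minimum of the quadratic form on the unit sphere is a margin for perturbations.\<close>

lemma pos_definite_neighbourhood:
  assumes pos: "\<And>x. x \<noteq> 0 \<Longrightarrow> 0 < x \<bullet> (D *v x)"
  obtains m where "0 < m"
    and "\<And>D'::real^'k^'k. \<And>x. dist D D' < m \<Longrightarrow> x \<noteq> 0 \<Longrightarrow> 0 < x \<bullet> (D' *v x)"
proof -
  have cont: "continuous_on (sphere 0 1) (\<lambda>x. x \<bullet> (D *v x))"
    by (intro continuous_intros linear_continuous_on matrix_vector_mul_bounded_linear)
  have ne: "sphere (0::real^'k) 1 \<noteq> {}"
    by simp
  obtain z where z: "z \<in> sphere 0 1" "\<And>y. y \<in> sphere 0 1 \<Longrightarrow> z \<bullet> (D *v z) \<le> y \<bullet> (D *v y)"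
    using continuous_attains_inf[OF compact_sphere ne cont] by blast
  define m where "m = z \<bullet> (D *v z)"
  have bound: "m * (norm x)\<^sup>2 \<le> x \<bullet> (D *v x)" for x
  proof (cases "x = 0")
    case False
    then have "m \<le> (x /\<^sub>R norm x) \<bullet> (D *v (x /\<^sub>R norm x))"
      unfolding m_def by (intro z) simp
    also have "\<dots> = (x \<bullet> (D *v x)) / (norm x)\<^sup>2"
      by (simp add: matrix_vector_mult_scaleR power2_eq_square divide_simps)
    finally show ?thesis
      using False by (simp add: field_simps)
  qed simp
  show thesis
  proof
    show "0 < m"
      unfolding m_def by (rule pos) (use z(1) in auto)
    fix D' :: "real^'k^'k" and x :: "real^'k"
    assume near: "dist D D' < m" and x: "x \<noteq> 0"
    have "\<bar>x \<bullet> ((D - D') *v x)\<bar> \<le> norm x * (norm (D - D') * norm x)"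
      by (rule order_trans[OF Cauchy_Schwarz_ineq2])
        (intro mult_left_mono norm_matrix_vector_mult_le norm_ge_zero)
    also have "\<dots> < m * (norm x)\<^sup>2"
      using near x by (simp add: dist_norm power2_eq_square)
    finally have "x \<bullet> ((D - D') *v x) < m * (norm x)\<^sup>2"
      by simp
    then show "0 < x \<bullet> (D' *v x)"
      using bound[of x] by (simp add: algebra_simps)
  qed
qed

text \<open>The map \<open>(D, C) \<mapsto> (D, D C + C D)\<close> is polynomial with invertible derivative, and
  \<open>(D, B) \<mapsto> (D, sylvester D B)\<close> is its local inverse; so the inverse function theorem applies.\<close>

lemma sylvester_differentiable:
  fixes D\<^sub>0 B\<^sub>0 :: "real^'k^'k"
  assumes pos: "\<And>x. x \<noteq> 0 \<Longrightarrow> 0 < x \<bullet> (D\<^sub>0 *v x)"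
  shows "(\<lambda>p. sylvester (fst p) (snd p)) differentiable (at (D\<^sub>0, B\<^sub>0))"
proof -
  obtain m where m: "0 < m"
    "\<And>D'::real^'k^'k. \<And>x. dist D\<^sub>0 D' < m \<Longrightarrow> x \<noteq> 0 \<Longrightarrow> 0 < x \<bullet> (D' *v x)"
    using pos_definite_neighbourhood[OF pos] by blast
  define C\<^sub>0 where "C\<^sub>0 = sylvester D\<^sub>0 B\<^sub>0"
  define f where "f = (\<lambda>p. (fst p, fst p ** snd p + snd p ** fst p :: real^'k^'k))"
  define g where "g = (\<lambda>p. (fst p, sylvester (fst p) (snd p) :: real^'k^'k))"
  define f' where "f' = (\<lambda>p. (fst p,
    (D\<^sub>0 ** snd p + fst p ** C\<^sub>0) + (C\<^sub>0 ** fst p + snd p ** D\<^sub>0) :: real^'k^'k))"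
  define g' where "g' = (\<lambda>p. (fst p,
    sylvester D\<^sub>0 (snd p - fst p ** C\<^sub>0 - C\<^sub>0 ** fst p) :: real^'k^'k))"
  have der: "(f has_derivative (\<lambda>p. (fst p,
    (fst z ** snd p + fst p ** snd z) + (snd z ** fst p + snd p ** fst z)))) (at z)" for z
    unfolding f_def
    by (intro has_derivative_Pair has_derivative_add derivative_intros
        bounded_bilinear.FDERIV[OF bounded_bilinear_matrix_mult])
  have "(g has_derivative g') (at (f (D\<^sub>0, C\<^sub>0)))"
  proof (rule has_derivative_inverse_strong[where S = "ball D\<^sub>0 m \<times> UNIV" and f = f and f' = f'
        and x = "(D\<^sub>0, C\<^sub>0)"])
    show "open (ball D\<^sub>0 m \<times> (UNIV :: (real^'k^'k) set))"
      by (intro open_Times) auto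
    show "(D\<^sub>0, C\<^sub>0) \<in> ball D\<^sub>0 m \<times> UNIV"
      using m(1) by simp
    show "continuous_on (ball D\<^sub>0 m \<times> UNIV) f"
      by (intro continuous_at_imp_continuous_on ballI has_derivative_continuous[OF der])
    show "g (f z) = z" if "z \<in> ball D\<^sub>0 m \<times> UNIV" for z
      using that sylvester_unique[OF m(2), of "fst z"] by (auto simp: f_def g_def)
    show "(f has_derivative f') (at (D\<^sub>0, C\<^sub>0))"
      using der[of "(D\<^sub>0, C\<^sub>0)"] by (simp add: f'_def)
    show "f' \<circ> g' = id"
    proof
      fix p :: "(real^'k^'k) \<times> (real^'k^'k)"
      show "(f' \<circ> g') p = id p"
        using sylvester_solves[OF pos, of "snd p - fst p ** C\<^sub>0 - C\<^sub>0 ** fst p"]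
        by (cases p) (simp add: f'_def g'_def algebra_simps)
    qed
  qed
  moreover have "f (D\<^sub>0, C\<^sub>0) = (D\<^sub>0, B\<^sub>0)"
    by (simp add: f_def C\<^sub>0_def sylvester_solves[OF pos])
  ultimately have "((\<lambda>p. snd (g p)) has_derivative (\<lambda>p. snd (g' p))) (at (D\<^sub>0, B\<^sub>0))"
    by (auto intro: has_derivative_snd)
  then show ?thesis
    by (auto simp: g_def differentiable_def)
qed

lemma differentiable_sylvester_compose:
  assumes D: "D differentiable (at u)" and B: "B differentiable (at u)"
    and pos: "\<And>x. x \<noteq> 0 \<Longrightarrow> 0 < x \<bullet> (D u *v x)"
  shows "(\<lambda>u. sylvester (D u) (B u)) differentiable (at u)"
proof -
  have "(\<lambda>u. (D u, B u)) differentiable (at u)"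
    using D B has_derivative_Pair unfolding differentiable_def by blast
  from differentiable_chain_at[OF this sylvester_differentiable[OF pos]] show ?thesis
    by (simp add: o_def)
qed

section \<open>The Bures--Wasserstein metric through symmetric lifts\<close>

lemma stiefel_cancel:
  assumes "Q \<in> stiefel"
  shows "transpose Q ** Q = mat 1" and "X ** transpose Q ** Q = X"
  using assms by (simp_all add: stiefel_def flip: matrix_mul_assoc)

text \<open>The range of \<open>\<Sigma>\<close> determines the orthogonal projector: each of the two projectors fixes the
  range of the other one.\<close>

lemma range_projector_eq:
  fixes Q :: "real^'k^'n" and Q' :: "real^'k^'n"
  assumes Q: "Q \<in> stiefel" "D \<in> sym_pos" and Q': "Q' \<in> stiefel" "D' \<in> sym_pos"
    and eq: "Q ** D ** transpose Q = Q' ** D' ** transpose Q'"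
  shows "Q' ** transpose Q' = Q ** transpose Q"
proof -
  have absorb: "(A ** transpose A) ** (B ** transpose B) = B ** transpose B"
    if A: "A \<in> stiefel" and B: "B \<in> stiefel" "F \<in> sym_pos"
      and AB: "A ** C ** transpose A = B ** F ** transpose B"
    for A B :: "real^'k^'n" and C F :: "real^'k^'k"
  proof -
    obtain E where E: "F ** E = mat 1"
      using sym_pos_inverse[OF B(2)] by metis
    have "(B ** F ** transpose B) ** B ** E = B ** (F ** E)"
      by (simp add: matrix_mul_assoc stiefel_cancel(2)[OF B(1)])
    then have B_eq: "B = (A ** C ** transpose A) ** B ** E"
      by (simp add: E AB)
    have "A ** transpose A ** B = B"
      by (subst (1 2) B_eq) (simp add: matrix_mul_assoc stiefel_cancel(2)[OF A])
    then show ?thesis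
      by (simp add: matrix_mul_assoc)
  qed
  have "Q' ** transpose Q' = transpose ((Q ** transpose Q) ** (Q' ** transpose Q'))"
    by (simp only: absorb[OF Q(1) Q' eq] matrix_transpose_mul transpose_transpose)
  also have "\<dots> = (Q' ** transpose Q') ** (Q ** transpose Q)"
    by (simp only: matrix_transpose_mul transpose_transpose)
  also have "\<dots> = Q ** transpose Q"
    by (rule absorb[OF Q'(1) Q eq[symmetric]])
  finally show ?thesis .
qed

lemma null_projector_eq:
  assumes Q: "Q \<in> stiefel" and D: "D \<in> sym_pos"
  shows "null_projector (Q ** D ** transpose Q) = mat 1 - Q ** transpose Q"
  unfolding null_projector_def
proof (rule the_equality)
  let ?R = "mat 1 - Q ** transpose Q" and ?K = "{x. Q ** D ** transpose Q *v x = 0}"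
  obtain E where E: "E ** D = mat 1"
    using sym_pos_inverse[OF D] by metis
  have sym: "transpose ?R = ?R"
    by (simp add: transpose_simps)
  have idem: "?R ** ?R = ?R"
    by (simp add: matrix_mult_simps matrix_mul_assoc stiefel_cancel[OF Q])
  have "Q ** D ** transpose Q ** ?R = 0"
    by (simp add: matrix_mult_simps matrix_mul_assoc stiefel_cancel[OF Q])
  then have "range (\<lambda>x. ?R *v x) \<subseteq> ?K"
    by (auto simp: matrix_vector_mul_assoc)
  moreover have "x \<in> range (\<lambda>x. ?R *v x)" if "x \<in> ?K" for x
  proof -
    have "Q ** transpose Q = Q ** E ** transpose Q ** (Q ** D ** transpose Q)"
      by (simp add: matrix_mul_assoc stiefel_cancel[OF Q])
        (simp add: E flip: matrix_mul_assoc)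
    then have "(Q ** transpose Q) *v x = 0"
      using that by (simp flip: matrix_vector_mul_assoc)
    then have "?R *v x = x"
      by (simp add: matrix_vector_mult_diff_rdistrib)
    then show ?thesis
      by (metis rangeI)
  qed
  ultimately have range: "range (\<lambda>x. ?R *v x) = ?K"
    by blast
  show "transpose ?R = ?R \<and> ?R ** ?R = ?R \<and> range (\<lambda>x. ?R *v x) = ?K"
    using sym idem range by simp
  fix R assume R: "transpose R = R \<and> R ** R = R \<and> range (\<lambda>x. R *v x) = ?K"
  have absorb: "A ** B = B" if idem: "A ** A = A" and range: "range (\<lambda>x. A *v x) = range (\<lambda>x. B *v x)"
    for A B :: "real^'n^'n"
    unfolding matrix_eq
  proof
    fix x
    obtain y where "B *v x = A *v y"
      using range by (metis rangeE rangeI)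
    then show "(A ** B) *v x = B *v x"
      using idem by (metis matrix_vector_mul_assoc)
  qed
  have "R = transpose (?R ** R)"
    using absorb[OF idem, of R] R range by simp
  also have "\<dots> = R ** ?R"
    using R sym by (simp add: matrix_transpose_mul)
  also have "\<dots> = ?R"
    using absorb[of R ?R] R range by simp
  finally show "R = ?R" .
qed

text \<open>The four Penrose equations make \<open>A X\<close> and \<open>A Y\<close> equal, since each absorbs the other and both are
  symmetric; likewise \<open>X A\<close> and \<open>Y A\<close>.\<close>

lemma pseudo_inverse_unique:
  fixes A :: "real^'n^'m"
  assumes X: "A ** X ** A = A" "X ** A ** X = X"
    "transpose (A ** X) = A ** X" "transpose (X ** A) = X ** A"
    and Y: "A ** Y ** A = A" "Y ** A ** Y = Y"
    "transpose (A ** Y) = A ** Y" "transpose (Y ** A) = Y ** A"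
  shows "X = Y"
proof -
  have "transpose ((A ** Y) ** (A ** X)) = (A ** X) ** (A ** Y)"
    by (simp only: matrix_transpose_mul[of "A ** Y"] X(3) Y(3))
  then have AX: "A ** X = A ** Y"
    using X(1,3) Y(1) by (simp add: matrix_mul_assoc)
  have "transpose ((X ** A) ** (Y ** A)) = (Y ** A) ** (X ** A)"
    by (simp only: matrix_transpose_mul[of "X ** A"] X(4) Y(4))
  moreover have "(X ** A) ** (Y ** A) = X ** (A ** Y ** A)"
    and "(Y ** A) ** (X ** A) = Y ** (A ** X ** A)"
    by (simp_all only: matrix_mul_assoc)
  ultimately have XA: "X ** A = Y ** A"
    using X(1,4) Y(1) by simp
  have "X = (X ** A) ** X"
    using X(2) by simp
  also have "\<dots> = Y ** (A ** X)"
    by (simp add: XA matrix_mul_assoc)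
  also have "\<dots> = Y"
    using Y(2) by (simp add: AX matrix_mul_assoc)
  finally show ?thesis .
qed

lemma pseudo_inverse_eq:
  assumes Q: "Q \<in> stiefel" and E: "D ** E = mat 1" "E ** D = mat 1"
  shows "pseudo_inverse (Q ** D ** transpose Q) = Q ** E ** transpose Q"
proof -
  let ?A = "Q ** D ** transpose Q" and ?X = "Q ** E ** transpose Q"
  have AX: "?A ** ?X = Q ** transpose Q"
    by (simp add: matrix_mul_assoc stiefel_cancel[OF Q]) (simp add: E flip: matrix_mul_assoc)
  have XA: "?X ** ?A = Q ** transpose Q"
    by (simp add: matrix_mul_assoc stiefel_cancel[OF Q]) (simp add: E flip: matrix_mul_assoc)
  have penrose: "?A ** ?X ** ?A = ?A \<and> ?X ** ?A ** ?X = ?X \<and>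
      transpose (?A ** ?X) = ?A ** ?X \<and> transpose (?X ** ?A) = ?X ** ?A"
    unfolding AX XA by (simp add: matrix_mul_assoc stiefel_cancel[OF Q] matrix_transpose_mul)
  show ?thesis
    unfolding pseudo_inverse_def
  proof (rule the_equality)
    fix X assume "?A ** X ** ?A = ?A \<and> X ** ?A ** X = X \<and>
      transpose (?A ** X) = ?A ** X \<and> transpose (X ** ?A) = X ** ?A"
    then show "X = ?X"
      by (intro pseudo_inverse_unique[of ?A X ?X]) (use penrose in blast)+
  qed (fact penrose)
qed

text \<open>Conjugating \<open>V = S \<Sigma> + \<Sigma> S\<close> by \<open>Q\<close> gives the Sylvester equation for \<open>Q\<^sup>T S Q\<close>, and
  \<open>Q Q\<^sup>T\<close> is the projector onto the range of \<open>\<Sigma>\<close> for every decomposition.\<close>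

lemma bw_S_eq:
  fixes Q :: "real^'k^'n"
  assumes Q: "Q \<in> stiefel" and D: "D \<in> sym_pos" and \<Sigma>: "\<Sigma> = Q ** D ** transpose Q"
    and V: "V = S ** \<Sigma> + \<Sigma> ** S"
  shows "bw_S TYPE('k) \<Sigma> V = (Q ** transpose Q) ** S ** (Q ** transpose Q)"
proof -
  have eq: "Q' ** sylvester D' (transpose Q' ** V ** Q') ** transpose Q'
      = (Q ** transpose Q) ** S ** (Q ** transpose Q)"
    if Q': "Q' \<in> stiefel" "D' \<in> sym_pos" and \<Sigma>': "\<Sigma> = Q' ** D' ** transpose Q'"
    for Q' :: "real^'k^'n" and D'
  proof -
    have conj: "transpose Q' ** V ** Q' = D' ** (transpose Q' ** S ** Q') + (transpose Q' ** S ** Q') ** D'"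
      by (simp add: V \<Sigma>' matrix_mult_simps matrix_mul_assoc stiefel_cancel[OF Q'(1)])
    have "sylvester D' (transpose Q' ** V ** Q') = transpose Q' ** S ** Q'"
      by (rule sylvester_unique[OF sym_posD(2)[OF Q'(2)] conj[symmetric]])
    then have "Q' ** sylvester D' (transpose Q' ** V ** Q') ** transpose Q'
        = (Q' ** transpose Q') ** S ** (Q' ** transpose Q')"
      by (simp only: matrix_mul_assoc)
    also have "Q' ** transpose Q' = Q ** transpose Q"
      by (rule range_projector_eq[OF Q D Q']) (simp flip: \<Sigma> \<Sigma>')
    finally show ?thesis .
  qed
  show ?thesis
    unfolding bw_S_def
  proof (rule the_equality)
    show "\<exists>Q'\<in>(stiefel :: (real^'k^'n) set). \<exists>D'\<in>sym_pos. \<Sigma> = Q' ** D' ** transpose Q' \<and>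
        (Q ** transpose Q) ** S ** (Q ** transpose Q)
          = Q' ** sylvester D' (transpose Q' ** V ** Q') ** transpose Q'"
      using Q D \<Sigma> eq[OF Q D \<Sigma>] by metis
  qed (use eq in auto)
qed

text \<open>Write \<open>p = Q Q\<^sup>T\<close> and \<open>r = 1 - p\<close>.  The first term of the metric is \<open>Tr (p S \<Sigma> S')\<close>, and
  because \<open>r V = r S \<Sigma>\<close> the second one is \<open>Tr (r S p W)\<close>, in which only the summand
  \<open>Tr (r S \<Sigma> S')\<close> survives.\<close>

lemma bw_metric_eq_inner:
  fixes Q :: "real^'k^'n"
  assumes Q: "Q \<in> stiefel" and D: "D \<in> sym_pos" and \<Sigma>: "\<Sigma> = Q ** D ** transpose Q"
    and S: "transpose S = S" and V: "V = S ** \<Sigma> + \<Sigma> ** S" and W: "W = S' ** \<Sigma> + \<Sigma> ** S'"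
  shows "bw_metric TYPE('k) \<Sigma> V W = S \<bullet> (\<Sigma> ** S')"
proof -
  let ?p = "Q ** transpose Q"
  let ?r = "mat 1 - ?p"
  obtain E where E: "D ** E = mat 1" "E ** D = mat 1"
    using sym_pos_inverse[OF D] by metis
  have p\<Sigma>: "?p ** \<Sigma> = \<Sigma>" "\<Sigma> ** ?p = \<Sigma>"
    by (simp_all add: \<Sigma> matrix_mul_assoc stiefel_cancel[OF Q])
  have r\<Sigma>: "?r ** \<Sigma> = 0" "\<Sigma> ** ?r = 0"
    using p\<Sigma> by (simp_all add: matrix_mult_simps)
  have pinv: "\<Sigma> ** pseudo_inverse \<Sigma> = ?p"
    unfolding \<Sigma> pseudo_inverse_eq[OF Q E]
    by (simp add: matrix_mul_assoc stiefel_cancel[OF Q]) (simp add: E flip: matrix_mul_assoc)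
  have "?r ** V ** pseudo_inverse \<Sigma> = (?r ** S) ** (\<Sigma> ** pseudo_inverse \<Sigma>)"
    by (simp add: V matrix_mult_simps(2) matrix_mul_assoc r\<Sigma>(1) matrix_mult_simps(7))
  then have "?r ** V ** pseudo_inverse \<Sigma> ** W = ?r ** S ** (?p ** W)"
    by (simp add: pinv matrix_mul_assoc)
  also have "?p ** W = ?p ** S' ** \<Sigma> + \<Sigma> ** S'"
    using p\<Sigma>(1) by (simp add: W matrix_mult_simps(2) matrix_mul_assoc)
  finally have "trace (?r ** V ** pseudo_inverse \<Sigma> ** W)
      = trace ((?r ** (S ** ?p ** S')) ** \<Sigma>) + trace (?r ** S ** \<Sigma> ** S')"
    by (simp add: matrix_mult_simps(2) trace_add matrix_mul_assoc)
  also have "trace ((?r ** (S ** ?p ** S')) ** \<Sigma>) = trace ((\<Sigma> ** ?r) ** (S ** ?p ** S'))"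
    by (subst trace_mul_sym) (simp add: matrix_mul_assoc)
  also have "\<dots> = 0"
    by (simp add: r\<Sigma>(2) matrix_mult_simps(7) trace_def)
  finally have second: "trace (?r ** V ** pseudo_inverse \<Sigma> ** W) = trace (?r ** (S ** \<Sigma> ** S'))"
    by (simp add: matrix_mul_assoc)
  have "(?p ** S ** ?p) ** \<Sigma> ** (?p ** S' ** ?p) = (?p ** S ** (?p ** \<Sigma> ** ?p) ** S') ** ?p"
    by (simp only: matrix_mul_assoc)
  also have "\<dots> = (?p ** S ** \<Sigma> ** S') ** ?p"
    by (simp only: p\<Sigma>)
  finally have "trace ((?p ** S ** ?p) ** \<Sigma> ** (?p ** S' ** ?p)) = trace (?p ** (?p ** S ** \<Sigma> ** S'))"
    by (simp only: trace_mul_sym[of _ ?p])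
  also have "?p ** (?p ** S ** \<Sigma> ** S') = ?p ** (S ** \<Sigma> ** S')"
    by (simp add: matrix_mul_assoc stiefel_cancel[OF Q])
  finally have "bw_metric TYPE('k) \<Sigma> V W
      = trace (?p ** (S ** \<Sigma> ** S')) + trace (?r ** (S ** \<Sigma> ** S'))"
    unfolding bw_metric_def bw_S_eq[OF Q D \<Sigma> V] bw_S_eq[OF Q D \<Sigma> W]
    using null_projector_eq[OF Q D] second by (simp add: \<Sigma>)
  also have "\<dots> = trace (S ** (\<Sigma> ** S'))"
    by (simp add: matrix_mult_simps(3) trace_sub matrix_mul_assoc)
  finally show ?thesis
    by (simp add: trace_eq_inner S)
qed

text \<open>The squared length \<open>Tr (S \<Sigma> S)\<close> equals \<open>S Q \<bullet> S Q D\<close>, so it vanishes only if \<open>S Q = 0\<close>;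
  this is the definiteness of the metric.\<close>

lemma inner_sandwich_pos_definite:
  fixes Q :: "real^'k^'n"
  assumes D: "D \<in> sym_pos" and \<Sigma>: "\<Sigma> = Q ** D ** transpose Q" and S: "transpose S = S"
  shows "0 \<le> S \<bullet> (\<Sigma> ** S)" and "S \<bullet> (\<Sigma> ** S) = 0 \<Longrightarrow> S ** \<Sigma> = 0 \<and> \<Sigma> ** S = 0"
proof -
  have eq: "S \<bullet> (\<Sigma> ** S) = (S ** Q) \<bullet> (S ** Q ** D)"
  proof -
    have "S \<bullet> (\<Sigma> ** S) = transpose S \<bullet> transpose (\<Sigma> ** S)"
      by (simp only: inner_transpose)
    also have "\<dots> = S \<bullet> (S ** Q ** D ** transpose Q)"
      using sym_posD(1)[OF D] by (simp add: S \<Sigma> matrix_transpose_mul matrix_mul_assoc)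
    finally show ?thesis
      by (simp add: inner_matrix_mult_right)
  qed
  show "0 \<le> S \<bullet> (\<Sigma> ** S)"
    unfolding eq by (rule inner_mult_pos_definite(1)[OF sym_posD(2)[OF D]])
  assume "S \<bullet> (\<Sigma> ** S) = 0"
  then have "S ** Q = 0"
    unfolding eq using inner_mult_pos_definite(2)[OF sym_posD(2)[OF D]] by blast
  then have "S ** \<Sigma> = 0"
    by (simp add: \<Sigma> matrix_mul_assoc matrix_mult_simps)
  moreover have "\<Sigma> ** S = transpose (S ** \<Sigma>)"
    using S sym_posD(1)[OF D] by (simp add: \<Sigma> matrix_transpose_mul matrix_mul_assoc)
  ultimately show "S ** \<Sigma> = 0 \<and> \<Sigma> ** S = 0"
    by (simp add: transpose_simps)
qed

section \<open>The tangent spaces of the manifold of rank \<open>k\<close> matrices\<close>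

text \<open>The tangent space at \<open>Q D Q\<^sup>T\<close>, which depends only on the range of \<open>Q\<close>.\<close>

definition tangent :: "real^'k^'n \<Rightarrow> (real^'n^'n) set" where
  "tangent Q = {V. transpose V = V \<and>
     (mat 1 - Q ** transpose Q) ** V ** (mat 1 - Q ** transpose Q) = 0}"

definition sym_outer :: "real^'n \<Rightarrow> real^'n \<Rightarrow> real^'n^'n" where
  "sym_outer v w = (\<chi> a b. v $ a * w $ b + w $ a * v $ b)"

lemma sym_outer_commute: "sym_outer v w = sym_outer w v"
  by (simp add: sym_outer_def vec_eq_iff algebra_simps)

lemma linear_sym_outer: "linear (\<lambda>v. sym_outer v w)"
  by (intro linearI) (simp_all add: sym_outer_def vec_eq_iff algebra_simps)

lemma sum_sym_outer_columns:
  "(\<Sum>j\<in>UNIV. sym_outer (column j Y) (column j Q)) = Y ** transpose Q + Q ** transpose Y"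
  by (simp add: vec_eq_iff sym_outer_def column_def matrix_matrix_mult_def transpose_def
      sum.distrib)

text \<open>Enumerating \<open>C\<close>, only the pairs in increasing order are needed.\<close>

lemma card_symmetric_image_le:
  assumes "finite C" and sym: "\<And>x y. f x y = f y x"
  shows "card (case_prod f ` (C \<times> C)) \<le> card C * (card C + 1) div 2"
proof -
  obtain h where h: "bij_betw h {0..<card C} C"
    using ex_bij_betw_nat_finite[OF assms(1)] by blast
  let ?I = "SIGMA j:{0..<card C}. {..j}"
  have "f x y \<in> (\<lambda>(j, i). f (h i) (h j)) ` ?I" if xy: "x \<in> C" "y \<in> C" for x y
  proof -
    have "x \<in> h ` {0..<card C}" "y \<in> h ` {0..<card C}"
      using xy h by (simp_all add: bij_betw_def)
    then obtain i j where ij: "x = h i" "i < card C" "y = h j" "j < card C"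
      by auto
    show ?thesis
    proof (cases "i \<le> j")
      case True
      then show ?thesis
        using ij by (force simp: image_iff)
    next
      case False
      then have "(i, j) \<in> ?I" "f x y = f (h j) (h i)"
        using ij sym by auto
      then show ?thesis
        by (force simp: image_iff)
    qed
  qed
  then have "case_prod f ` (C \<times> C) \<subseteq> (\<lambda>(j, i). f (h i) (h j)) ` ?I"
    by auto
  then have "card (case_prod f ` (C \<times> C)) \<le> card ?I"
    by (meson card_image_le card_mono finite_SigmaI finite_atLeastLessThan finite_atMost
        finite_imageI order_trans)
  also have "card ?I = (\<Sum>j<card C. Suc j)"
    by (simp add: atLeast0LessThan)
  also have "(\<Sum>j<m. Suc j) = m * (m + 1) div 2" for m
    by (induction m) auto
  finally show ?thesis .
qed

lemma stiefel_columns: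
  fixes Q :: "real^'k^'n"
  assumes "Q \<in> stiefel"
  shows "column i Q \<bullet> column j Q = (if i = j then 1 else 0)"
    and "independent (columns Q)" and "card (columns Q) = CARD('k)"
proof -
  have "(transpose Q ** Q) $ i $ j = column i Q \<bullet> column j Q" for i j
    by (simp add: matrix_mult_transpose_dot_column)
  then show inner: "column i Q \<bullet> column j Q = (if i = j then 1 else 0)" for i j
    using stiefel_cancel(1)[OF assms] by (simp add: mat_def)
  have cols: "columns Q = range (\<lambda>i. column i Q)"
    by (auto simp: columns_def)
  have "inj (\<lambda>i. column i Q)"
    by (rule injI) (metis inner zero_neq_one)
  then show "card (columns Q) = CARD('k)"
    by (simp add: cols card_image)
  show "independent (columns Q)"
  proof (rule pairwise_orthogonal_independent)
    show "pairwise orthogonal (columns Q)"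
      by (auto simp: pairwise_def cols orthogonal_def inner)
    show "0 \<notin> columns Q"
      by (auto simp: cols) (metis inner inner_zero_left zero_neq_one)
  qed
qed

text \<open>Every tangent vector is \<open>Y Q\<^sup>T + Q Y\<^sup>T\<close>, a sum of symmetrized products \<open>y \<odot> q\<close> with \<open>q\<close> a
  column of \<open>Q\<close>.  Extending the columns to a basis of the whole space, it is enough to take \<open>y\<close> in
  that basis; this leaves \<open>k (n - k)\<close> products in which \<open>y\<close> is a new vector, and \<open>k (k + 1) / 2\<close>
  products of two columns.\<close>

lemma dim_tangent_le:
  fixes Q :: "real^'k^'n"
  assumes "Q \<in> stiefel"
  shows "dim (tangent Q) \<le> CARD(('n, 'k) coord)"
proof -
  let ?C = "columns Q"
  obtain B where B: "?C \<subseteq> B" "independent B" "UNIV \<subseteq> span B"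
    using maximal_independent_subset_extend[of ?C UNIV] stiefel_columns(2)[OF assms] by auto
  have finB: "finite B"
    using B(2) independent_imp_finite by blast
  have cardB: "card B = CARD('n)"
    using basis_card_eq_dim[of B UNIV] B by simp
  define G where "G = case_prod sym_outer ` ((B - ?C) \<times> ?C) \<union> case_prod sym_outer ` (?C \<times> ?C)"
  have finC: "finite ?C"
    using finB B(1) finite_subset by blast
  have G: "sym_outer b q \<in> G" if "b \<in> B" "q \<in> ?C" for b q
    using that unfolding G_def by (cases "b \<in> ?C") auto
  have span: "sym_outer y q \<in> span G" if "q \<in> ?C" for y q
  proof -
    have "(\<lambda>v. sym_outer v q) ` span B = span ((\<lambda>v. sym_outer v q) ` B)"
      by (rule linear_span_image[OF linear_sym_outer, symmetric])
    also have "\<dots> \<subseteq> span G"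
      using G that by (intro span_mono) auto
    finally show ?thesis
      using B(3) by auto
  qed
  have "tangent Q \<subseteq> span G"
  proof
    fix V assume "V \<in> tangent Q"
    then have V: "transpose V = V"
      "(mat 1 - Q ** transpose Q) ** V ** (mat 1 - Q ** transpose Q) = 0"
      by (auto simp: tangent_def)
    \<comment> \<open>The block of \<open>V\<close> on the range of \<open>Q\<close> occurs in both summands, hence the half.\<close>
    define Y where "Y = V ** Q - (1/2) *\<^sub>R (Q ** transpose Q ** V ** Q)"
    have "Y ** transpose Q + Q ** transpose Y
        = V - (mat 1 - Q ** transpose Q) ** V ** (mat 1 - Q ** transpose Q)"
      using V(1) unfolding Y_def
      by (simp add: matrix_mult_simps transpose_simps matrix_mul_assoc algebra_simps
          flip: scaleR_add_left)
    then have "V = (\<Sum>j\<in>UNIV. sym_outer (column j Y) (column j Q))"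
      by (simp add: V(2) sum_sym_outer_columns)
    also have "\<dots> \<in> span G"
      by (intro span_sum span) (auto simp: columns_def)
    finally show "V \<in> span G" .
  qed
  moreover have "finite G"
    using finB finC by (simp add: G_def)
  ultimately have "dim (tangent Q) \<le> card G"
    by (rule dim_le_card)
  also have "card G \<le> card ((B - ?C) \<times> ?C) + card ?C * (card ?C + 1) div 2"
    unfolding G_def
    by (intro order_trans[OF card_Un_le] add_mono card_image_le card_symmetric_image_le
        finite_cartesian_product finite_Diff finB finC sym_outer_commute)
  also have "\<dots> = CARD('k) * (CARD('n) - CARD('k)) + CARD('k) * (CARD('k) + 1) div 2"
    using stiefel_columns(3)[OF assms] cardB B(1) finC
    by (simp add: card_cartesian_product card_Diff_subset)
  also have "\<dots> = CARD(('n, 'k) coord)"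
    using type_definition.card[OF type_definition_coord[where 'n = 'n and 'k = 'k]]
    by simp
  finally show ?thesis .
qed

text \<open>The coordinate space has at least the dimension of the tangent space.\<close>

lemma immersion_onto_tangent:
  fixes Q :: "real^'k^'n" and g :: "real^('n, 'k) coord \<Rightarrow> real^'n^'n"
  assumes Q: "Q \<in> stiefel" and g: "linear g" "inj g" "range g \<subseteq> tangent Q"
  shows "range g = tangent Q"
proof -
  have "subspace (range g)"
    using g(1) by (intro linear_subspace_image) auto
  moreover have "subspace (tangent Q)"
    unfolding tangent_def subspace_def
    by (auto simp: transpose_simps matrix_mult_simps(1,2,7-10))
  moreover have "dim (tangent Q) \<le> dim (range g)"
    using dim_tangent_le[OF Q] dim_image_eq[OF g(1), of UNIV] g(2)
    by (simp add: inj_on_subset)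
  ultimately show ?thesis
    using g(3) by (intro subspace_dim_equal) auto
qed

text \<open>The tangent vector \<open>H \<Sigma> + \<Sigma> H\<close> detects \<open>H \<Sigma>\<close>.\<close>

lemma orthogonal_tangent_imp:
  assumes Q: "Q \<in> stiefel" and D: "D \<in> sym_pos" and \<Sigma>: "\<Sigma> = Q ** D ** transpose Q"
    and H: "transpose H = H" and orth: "\<And>V. V \<in> tangent Q \<Longrightarrow> H \<bullet> V = 0"
  shows "H ** \<Sigma> = 0" and "\<Sigma> ** H = 0"
proof -
  have sym: "transpose \<Sigma> = \<Sigma>"
    using sym_posD(1)[OF D] by (simp add: \<Sigma> matrix_transpose_mul matrix_mul_assoc)
  have "H ** \<Sigma> + \<Sigma> ** H \<in> tangent Q"
    unfolding tangent_def using sym H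
    by (auto simp: transpose_simps add.commute)
      (simp add: \<Sigma> matrix_mult_simps matrix_mul_assoc stiefel_cancel[OF Q])
  then have "H \<bullet> (H ** \<Sigma>) + H \<bullet> (\<Sigma> ** H) = 0"
    using orth by (simp flip: inner_add_right)
  moreover have "H \<bullet> (H ** \<Sigma>) = H \<bullet> (\<Sigma> ** H)"
    using inner_transpose[of H "\<Sigma> ** H"] by (simp add: matrix_transpose_mul sym H)
  ultimately show "H ** \<Sigma> = 0" "\<Sigma> ** H = 0"
    using inner_sandwich_pos_definite(2)[OF D \<Sigma> H] by auto
qed

section \<open>Partial derivatives and the Euler--Lagrange equation of a metric\<close>

lemma differentiable_has_derivative:
  "f differentiable (at u) \<Longrightarrow> (f has_derivative frechet_derivative f (at u)) (at u)"
  by (simp add: frechet_derivative_works)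

lemma frechet_derivative_eq: "(f has_derivative f') (at u) \<Longrightarrow> frechet_derivative f (at u) v = f' v"
  by (metis frechet_derivative_at)

lemma frechet_derivative_eq_partials:
  fixes f :: "real^'d \<Rightarrow> 'b::real_normed_vector"
  assumes "f differentiable (at u)"
  shows "frechet_derivative f (at u) v = (\<Sum>i\<in>UNIV. v $ i *\<^sub>R partial i f u)"
proof -
  have lin: "linear (frechet_derivative f (at u))"
    by (rule linear_frechet_derivative[OF assms])
  have "v = (\<Sum>i\<in>UNIV. v $ i *\<^sub>R axis i 1)"
    using basis_expansion[of v] by (simp add: scalar_mult_eq_scaleR)
  then have "frechet_derivative f (at u) v
      = frechet_derivative f (at u) (\<Sum>i\<in>UNIV. v $ i *\<^sub>R axis i 1)"
    by simp
  then show ?thesis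
    by (simp add: linear_sum[OF lin] linear_cmul[OF lin] partial_def)
qed

lemma has_vector_derivative_compose:
  assumes "(f has_derivative f') (at (x s))" and "(x has_vector_derivative x') (at s)"
  shows "((\<lambda>s. f (x s)) has_vector_derivative f' x') (at s)"
proof -
  have "((f \<circ> x) has_derivative (f' \<circ> (\<lambda>h. h *\<^sub>R x'))) (at s)"
    using assms by (intro diff_chain_at) (simp_all add: has_vector_derivative_def)
  moreover have "f' \<circ> (\<lambda>h. h *\<^sub>R x') = (\<lambda>h. h *\<^sub>R f' x')"
    using linear_cmul[OF has_derivative_linear[OF assms(1)]] by auto
  ultimately show ?thesis
    by (simp add: has_vector_derivative_def o_def)
qed

lemma differentiable_bilinear:
  assumes "bounded_bilinear B" "f differentiable (at u)" "g differentiable (at u)"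
  shows "(\<lambda>u. B (f u) (g u)) differentiable (at u)"
  using bounded_bilinear.FDERIV[OF assms(1)] assms(2,3) unfolding differentiable_def by blast

lemma differentiable_linear:
  assumes "bounded_linear L" "f differentiable (at u)"
  shows "(\<lambda>u. L (f u)) differentiable (at u)"
  using bounded_linear.has_derivative[OF assms(1)] assms(2) unfolding differentiable_def by blast

lemmas differentiable_matrix_mult = differentiable_bilinear[OF bounded_bilinear_matrix_mult]
lemmas differentiable_inner_prod = differentiable_bilinear[OF bounded_bilinear_inner]
lemmas differentiable_transpose = differentiable_linear[OF bounded_linear_transpose]

lemma has_derivative_transform_on:
  assumes "(f has_derivative f') (at u)" "open N" "u \<in> N" "\<And>y. y \<in> N \<Longrightarrow> f y = g y"
  shows "(g has_derivative f') (at u)"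
  using assms by (rule has_derivative_transform_within_open)

text \<open>By the mean value theorem in direction \<open>v\<close> the second difference is \<open>t\<close> times an increment,
  over \<open>t w\<close>, of the derivative in direction \<open>v\<close>.\<close>

lemma second_difference:
  fixes f :: "'a::real_normed_vector \<Rightarrow> real"
  assumes N: "open N" "u \<in> N" and f: "\<And>x. x \<in> N \<Longrightarrow> (f has_derivative f' x) (at x)"
    and L: "((\<lambda>x. f' x v) has_derivative L) (at u)" and e: "0 < e"
  obtains d where "0 < d" "\<And>t. 0 < t \<Longrightarrow> t < d \<Longrightarrow>
    \<bar>f (u + t *\<^sub>R v + t *\<^sub>R w) - f (u + t *\<^sub>R v) - f (u + t *\<^sub>R w) + f u - t\<^sup>2 * L w\<bar>
      \<le> e * t\<^sup>2"
proof -
  define K where "K = 2 * norm v + norm w + 1"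
  have K: "0 < K"
    by (simp add: K_def add_pos_nonneg add_nonneg_pos)
  have linL: "linear L"
    using L by (rule has_derivative_linear)
  obtain d1 where d1: "0 < d1" "\<And>y. norm (y - u) < d1 \<Longrightarrow>
      norm (f' y v - f' u v - L (y - u)) \<le> e / K * norm (y - u)"
    using L e K unfolding has_derivative_at_alt by (meson divide_pos_pos)
  obtain d2 where d2: "0 < d2" "ball u d2 \<subseteq> N"
    using N open_contains_ball by blast
  \<comment> \<open>For \<open>t < d\<close> the points \<open>u + s v + r w\<close> with \<open>0 \<le> s, r \<le> t\<close> lie within \<open>d1\<close> and \<open>d2\<close> of \<open>u\<close>,
    and \<open>t (K - 1)\<close> bounds the sum of the two error terms.\<close>
  define d where "d = min d1 d2 / K"
  show thesis
  proof
    show "0 < d"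
      using d1(1) d2(1) K by (simp add: d_def)
    fix t :: real assume t: "0 < t" "t < d"
    have tK: "t * K < min d1 d2"
      using t K by (simp add: d_def pos_less_divide_eq)
    have small: "norm (s *\<^sub>R v + r *\<^sub>R w) \<le> t * (norm v + norm w)"
      if "0 \<le> s" "s \<le> t" "0 \<le> r" "r \<le> t" for s r
    proof -
      have "norm (s *\<^sub>R v + r *\<^sub>R w) \<le> s * norm v + r * norm w"
        using that by (metis abs_of_nonneg norm_scaleR norm_triangle_ineq)
      also have "\<dots> \<le> t * norm v + t * norm w"
        using that by (intro add_mono mult_right_mono) auto
      finally show ?thesis
        by (simp add: distrib_left)
    qed
    have "t * (norm v + norm w) \<le> t * K"
      using t(1) by (intro mult_left_mono) (auto simp: K_def)
    then have small': "norm (s *\<^sub>R v + r *\<^sub>R w) < d1" "norm (s *\<^sub>R v + r *\<^sub>R w) < d2"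
      if "0 \<le> s" "s \<le> t" "0 \<le> r" "r \<le> t" for s r
      using small[OF that] tK by auto
    have inN: "u + s *\<^sub>R v + r *\<^sub>R w \<in> N" if "0 \<le> s" "s \<le> t" "0 \<le> r" "r \<le> t" for s r
      using small'(2)[OF that] d2(2) by (auto simp: subset_iff dist_norm norm_minus_commute add.assoc)
    have der: "((\<lambda>s. f (u + s *\<^sub>R v + r *\<^sub>R w)) has_real_derivative f' (u + s *\<^sub>R v + r *\<^sub>R w) v) (at s)"
      if "0 \<le> s" "s \<le> t" "0 \<le> r" "r \<le> t" for s r
    proof -
      have "((\<lambda>s. u + s *\<^sub>R v + r *\<^sub>R w) has_vector_derivative v) (at s)"
        by (auto intro!: derivative_eq_intros simp: has_vector_derivative_def)
      from has_vector_derivative_compose[OF f[OF inN[OF that]] this] show ?thesis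
        by (simp add: has_real_derivative_iff_has_vector_derivative)
    qed
    define \<phi> where "\<phi> = (\<lambda>s. f (u + s *\<^sub>R v + t *\<^sub>R w) - f (u + s *\<^sub>R v + 0 *\<^sub>R w))"
    have "\<exists>z>0. z < t \<and> \<phi> t - \<phi> 0
        = (t - 0) * (f' (u + z *\<^sub>R v + t *\<^sub>R w) v - f' (u + z *\<^sub>R v + 0 *\<^sub>R w) v)"
      unfolding \<phi>_def using t(1) by (intro MVT2 DERIV_diff der) auto
    then obtain z where z: "0 < z" "z < t" and mvt: "\<phi> t - \<phi> 0
        = t * (f' (u + z *\<^sub>R v + t *\<^sub>R w) v - f' (u + z *\<^sub>R v + 0 *\<^sub>R w) v)"
      by auto
    have est: "\<bar>f' (u + z *\<^sub>R v + r *\<^sub>R w) v - f' u v - L (z *\<^sub>R v + r *\<^sub>R w)\<bar>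
        \<le> e / K * norm (z *\<^sub>R v + r *\<^sub>R w)" if "0 \<le> r" "r \<le> t" for r
      using d1(2)[of "u + z *\<^sub>R v + r *\<^sub>R w"] small'(1)[of z r] z that by (simp add: add.assoc)
    have "L (z *\<^sub>R v + t *\<^sub>R w) - L (z *\<^sub>R v + 0 *\<^sub>R w) = t * L w"
      by (simp add: linear_add[OF linL] linear_cmul[OF linL])
    then have "\<bar>(f' (u + z *\<^sub>R v + t *\<^sub>R w) v - f' (u + z *\<^sub>R v + 0 *\<^sub>R w) v) - t * L w\<bar>
        \<le> e / K * norm (z *\<^sub>R v + t *\<^sub>R w) + e / K * norm (z *\<^sub>R v + 0 *\<^sub>R w)"
      using est[of t] est[of 0] t(1) by linarith
    also have "\<dots> \<le> e / K * (t * (norm v + norm w)) + e / K * (t * norm v)"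
      using small[of z t] z t(1) e K by (intro add_mono mult_left_mono) (auto intro: mult_right_mono)
    also have "\<dots> = e / K * (t * (K - 1))"
      by (simp add: K_def distrib_left)
    also have "\<dots> \<le> e / K * (t * K)"
      using t(1) e K by (intro mult_left_mono) auto
    also have "\<dots> = e * t"
      using K by simp
    finally have bound: "\<bar>(f' (u + z *\<^sub>R v + t *\<^sub>R w) v - f' (u + z *\<^sub>R v + 0 *\<^sub>R w) v) - t * L w\<bar>
        \<le> e * t" .
    have "f (u + t *\<^sub>R v + t *\<^sub>R w) - f (u + t *\<^sub>R v) - f (u + t *\<^sub>R w) + f u - t\<^sup>2 * L w
        = t * ((f' (u + z *\<^sub>R v + t *\<^sub>R w) v - f' (u + z *\<^sub>R v + 0 *\<^sub>R w) v) - t * L w)"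
      using mvt by (simp add: \<phi>_def algebra_simps power2_eq_square)
    also have "\<bar>\<dots>\<bar> \<le> t * (e * t)"
      using bound t(1) by (simp add: abs_mult)
    finally show "\<bar>f (u + t *\<^sub>R v + t *\<^sub>R w) - f (u + t *\<^sub>R v) - f (u + t *\<^sub>R w) + f u - t\<^sup>2 * L w\<bar>
        \<le> e * t\<^sup>2"
      by (simp add: power2_eq_square algebra_simps)
  qed
qed

text \<open>The second difference is symmetric in \<open>v\<close> and \<open>w\<close>, so both \<open>L w\<close> and \<open>M v\<close> are its leading
  coefficient.\<close>

lemma second_derivative_symmetric_real:
  fixes f :: "'a::real_normed_vector \<Rightarrow> real"
  assumes N: "open N" "u \<in> N" and f: "\<And>x. x \<in> N \<Longrightarrow> (f has_derivative f' x) (at x)"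
    and L: "((\<lambda>x. f' x v) has_derivative L) (at u)" and M: "((\<lambda>x. f' x w) has_derivative M) (at u)"
  shows "L w = M v"
proof -
  have "\<bar>L w - M v\<bar> \<le> e" if e: "0 < e" for e
  proof -
    have e2: "0 < e / 2"
      using e by simp
    obtain d1 where d1: "0 < d1" "\<And>t. 0 < t \<Longrightarrow> t < d1 \<Longrightarrow>
        \<bar>f (u + t *\<^sub>R v + t *\<^sub>R w) - f (u + t *\<^sub>R v) - f (u + t *\<^sub>R w) + f u - t\<^sup>2 * L w\<bar>
          \<le> e / 2 * t\<^sup>2"
      using second_difference[OF N f L e2, of w] by blast
    obtain d2 where d2: "0 < d2" "\<And>t. 0 < t \<Longrightarrow> t < d2 \<Longrightarrow>
        \<bar>f (u + t *\<^sub>R w + t *\<^sub>R v) - f (u + t *\<^sub>R w) - f (u + t *\<^sub>R v) + f u - t\<^sup>2 * M v\<bar>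
          \<le> e / 2 * t\<^sup>2"
      using second_difference[OF N f M e2, of v] by blast
    define t where "t = min d1 d2 / 2"
    have t: "0 < t" "t < d1" "t < d2"
      using d1(1) d2(1) by (auto simp: t_def)
    have "u + t *\<^sub>R w + t *\<^sub>R v = u + t *\<^sub>R v + t *\<^sub>R w"
      by simp
    then have "\<bar>t\<^sup>2 * L w - t\<^sup>2 * M v\<bar> \<le> e / 2 * t\<^sup>2 + e / 2 * t\<^sup>2"
      using d1(2)[OF t(1,2)] d2(2)[OF t(1,3)] by (simp only:)
    moreover have "t\<^sup>2 * \<bar>L w - M v\<bar> = \<bar>t\<^sup>2 * L w - t\<^sup>2 * M v\<bar>"
      by (simp add: abs_mult flip: right_diff_distrib)
    ultimately have "t\<^sup>2 * \<bar>L w - M v\<bar> \<le> t\<^sup>2 * e"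
      by (simp add: mult.commute)
    then show ?thesis
      using t(1) by simp
  qed
  then have "\<bar>L w - M v\<bar> \<le> 0"
    by (rule field_le_epsilon) simp
  then show ?thesis
    by simp
qed

lemma second_derivative_symmetric:
  fixes f :: "'a::real_normed_vector \<Rightarrow> 'b::euclidean_space"
  assumes N: "open N" "u \<in> N" and f: "\<And>x. x \<in> N \<Longrightarrow> (f has_derivative f' x) (at x)"
    and L: "((\<lambda>x. f' x v) has_derivative L) (at u)" and M: "((\<lambda>x. f' x w) has_derivative M) (at u)"
  shows "L w = M v"
proof (rule euclidean_eqI)
  fix b :: 'b
  note inner_left = bounded_linear.has_derivative[OF bounded_linear_inner_left, of _ _ _ b]
  show "L w \<bullet> b = M v \<bullet> b"
    using second_derivative_symmetric_real[OF N inner_left[OF f] inner_left[OF L] inner_left[OF M]] .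
qed

lemma matrix_mult_matrix_inv: "invertible A \<Longrightarrow> A ** matrix_inv A = mat 1"
  unfolding invertible_def matrix_inv_def by (rule someI_ex[THEN conjunct1])

text \<open>The geodesic equation says that the momentum \<open>p\<^sub>m = \<Sum>\<^sub>l x'\<^sub>l G\<^sub>l\<^sub>m\<close> satisfies the
  Euler--Lagrange equation \<open>p\<^sub>m' = (1/2) \<partial>\<^sub>m G\<^sub>i\<^sub>j x'\<^sub>i x'\<^sub>j\<close> of the energy.\<close>

lemma euler_lagrange:
  fixes G :: "real^'d \<Rightarrow> real^'d^'d"
  assumes x: "(x has_vector_derivative x' s) (at s)"
    and x': "(x' has_vector_derivative
      (\<chi> l. - (\<Sum>i\<in>UNIV. \<Sum>j\<in>UNIV. christoffel G (x s) l i j * x' s $ i * x' s $ j))) (at s)"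
    and G: "\<And>i j. (\<lambda>u. G u $ i $ j) differentiable (at (x s))"
    and sym: "transpose (G (x s)) = G (x s)" and inv: "invertible (G (x s))"
  shows "((\<lambda>s. \<Sum>l\<in>UNIV. x' s $ l * G (x s) $ l $ m) has_vector_derivative
    (1/2) * (\<Sum>i\<in>UNIV. \<Sum>j\<in>UNIV. partial m (\<lambda>u. G u $ i $ j) (x s) * x' s $ i * x' s $ j)) (at s)"
proof -
  define a where "a = x' s"
  define g where "g k i j = partial k (\<lambda>u. G u $ i $ j) (x s)" for k i j
  define c where "c = (\<chi> m. \<Sum>i\<in>UNIV. \<Sum>j\<in>UNIV. (g i j m + g j i m - g m i j) * a $ i * a $ j)"
  define a' where "a' = (\<chi> l. - (\<Sum>i\<in>UNIV. \<Sum>j\<in>UNIV. christoffel G (x s) l i j * a $ i * a $ j))"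
  have dG: "((\<lambda>s. G (x s) $ l $ m) has_vector_derivative (\<Sum>i\<in>UNIV. a $ i * g i l m)) (at s)" for l
    using has_vector_derivative_compose[OF differentiable_has_derivative[OF G] x, of l m]
      frechet_derivative_eq_partials[OF G, of l m "x' s"]
    by (simp add: a_def g_def)
  have da: "((\<lambda>s. x' s $ l) has_vector_derivative a' $ l) (at s)" for l
    using bounded_linear.has_vector_derivative[OF bounded_linear_vec_nth x'] by (simp add: a'_def a_def)
  have "((\<lambda>s. \<Sum>l\<in>UNIV. x' s $ l * G (x s) $ l $ m) has_vector_derivative
      (\<Sum>l\<in>UNIV. a $ l * (\<Sum>i\<in>UNIV. a $ i * g i l m) + a' $ l * G (x s) $ l $ m)) (at s)"
    unfolding a_def by (intro has_vector_derivative_sum has_vector_derivative_mult da dG[unfolded a_def])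
  also have "(\<Sum>l\<in>UNIV. a $ l * (\<Sum>i\<in>UNIV. a $ i * g i l m) + a' $ l * G (x s) $ l $ m)
      = (\<Sum>l\<in>UNIV. \<Sum>i\<in>UNIV. g i l m * a $ i * a $ l) + (G (x s) *v a') $ m"
  proof -
    have "G (x s) $ l $ m = G (x s) $ m $ l" for l
      using arg_cong[OF sym, of "\<lambda>A. A $ m $ l"] by (simp add: transpose_def)
    then show ?thesis
      by (simp add: sum.distrib matrix_vector_mult_def sum_distrib_left mult_ac)
  qed
  also have "G (x s) *v a' = - (1/2) *\<^sub>R c"
  proof -
    have "a' $ l = (- (1/2) *\<^sub>R (matrix_inv (G (x s)) *v c)) $ l" for l
    proof -
      have "(\<Sum>i\<in>UNIV. \<Sum>j\<in>UNIV. christoffel G (x s) l i j * a $ i * a $ j)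
          = (\<Sum>i\<in>UNIV. \<Sum>j\<in>UNIV. \<Sum>k\<in>UNIV. (1/2) * (matrix_inv (G (x s)) $ l $ k *
              ((g i j k + g j i k - g k i j) * a $ i * a $ j)))"
        by (simp add: christoffel_def g_def sum_distrib_left sum_distrib_right mult_ac)
      also have "\<dots> = (\<Sum>i\<in>UNIV. \<Sum>k\<in>UNIV. \<Sum>j\<in>UNIV. (1/2) * (matrix_inv (G (x s)) $ l $ k *
              ((g i j k + g j i k - g k i j) * a $ i * a $ j)))"
        by (intro sum.cong refl sum.swap)
      also have "\<dots> = (\<Sum>k\<in>UNIV. \<Sum>i\<in>UNIV. \<Sum>j\<in>UNIV. (1/2) * (matrix_inv (G (x s)) $ l $ k *
              ((g i j k + g j i k - g k i j) * a $ i * a $ j)))"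
        by (rule sum.swap)
      also have "\<dots> = (1/2) * (matrix_inv (G (x s)) *v c) $ l"
        by (simp add: c_def matrix_vector_mult_def sum_distrib_left)
      finally show ?thesis
        by (simp add: a'_def)
    qed
    then have "a' = (- (1/2)) *\<^sub>R (matrix_inv (G (x s)) *v c)"
      by (simp only: vec_eq_iff) simp
    then show ?thesis
      by (simp only: matrix_vector_mult_scaleR matrix_vector_mul_assoc matrix_mult_matrix_inv[OF inv]
          matrix_vector_mul_lid)
  qed
  also have "(\<Sum>l\<in>UNIV. \<Sum>i\<in>UNIV. g i l m * a $ i * a $ l) + (- (1/2) *\<^sub>R c) $ m
      = (1/2) * (\<Sum>i\<in>UNIV. \<Sum>j\<in>UNIV. g m i j * a $ i * a $ j)"
  proof -
    have "(\<Sum>l\<in>UNIV. \<Sum>i\<in>UNIV. g i l m * a $ i * a $ l) = (\<Sum>i\<in>UNIV. \<Sum>j\<in>UNIV. g i j m * a $ i * a $ j)"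
      by (rule sum.swap)
    moreover have "(\<Sum>i\<in>UNIV. \<Sum>j\<in>UNIV. g j i m * a $ i * a $ j)
        = (\<Sum>i\<in>UNIV. \<Sum>j\<in>UNIV. g i j m * a $ i * a $ j)"
      by (subst sum.swap) (simp add: mult_ac)
    ultimately show ?thesis
      by (simp add: c_def sum.distrib sum_subtractf left_diff_distrib distrib_right diff_divide_distrib)
  qed
  finally show ?thesis
    by (simp add: g_def a_def)
qed

section \<open>Geodesics of the Bures--Wasserstein metric\<close>

text \<open>A local lift \<open>(Q, D)\<close> of a parametrization to \<open>St(n,k) \<times> Sym\<^sup>+(k)\<close>.  Its image in the symmetric
  matrices is \<open>F = Q D Q\<^sup>T\<close>; \<open>dQ v\<close>, \<open>dD v\<close> and \<open>dF v\<close> are derivatives in direction \<open>v\<close>.\<close>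

locale immersed_lift =
  fixes N :: "(real^('n::finite, 'k::finite) coord) set" and \<sigma> :: "real^('n, 'k) coord \<Rightarrow> ('n, 'k) pairs"
  assumes open_N: "open N" and smooth: "smooth_on N \<sigma>"
    and maps: "\<sigma> ` N \<subseteq> stiefel \<times> sym_pos"
    and immersion: "\<And>u v. u \<in> N \<Longrightarrow> frechet_derivative \<sigma> (at u) v \<in> vertical (\<sigma> u) \<Longrightarrow> v = 0"
begin

definition Q where "Q u = fst (\<sigma> u)"
definition D where "D u = snd (\<sigma> u)"
definition dQ where "dQ v u = fst (frechet_derivative \<sigma> (at u) v)"
definition dD where "dD v u = snd (frechet_derivative \<sigma> (at u) v)"
definition F where "F u = Q u ** D u ** transpose (Q u)"
definition dF where "dF v u = dQ v u ** D u ** transpose (Q u) + Q u ** dD v u ** transpose (Q u)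
  + Q u ** D u ** transpose (dQ v u)"
definition r where "r u = mat 1 - Q u ** transpose (Q u)"

text \<open>A symmetric solution of \<open>S F + F S = dF v\<close>.  Its block on the range of \<open>F\<close> solves the Sylvester
  equation; in the mixed blocks \<open>r (dF v) F\<^sup>\<dagger> = r (dQ v) Q\<^sup>T\<close>, which is differentiable because \<open>\<sigma>\<close> is
  smooth.\<close>

definition S where
  "S v u = Q u ** sylvester (D u) (transpose (Q u) ** dF v u ** Q u) ** transpose (Q u)
    + r u ** dQ v u ** transpose (Q u) + Q u ** transpose (dQ v u) ** r u"

lemma stiefel_Q: "u \<in> N \<Longrightarrow> Q u \<in> stiefel" and sym_pos_D: "u \<in> N \<Longrightarrow> D u \<in> sym_pos"
  using maps by (auto simp: Q_def D_def)

lemma diff_\<sigma>: "u \<in> N \<Longrightarrow> \<sigma> differentiable (at u)"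
  and diff_\<sigma>': "u \<in> N \<Longrightarrow> (\<lambda>x. frechet_derivative \<sigma> (at x) v) differentiable (at u)"
proof -
  have "cont_diff_on (Suc (Suc 0)) N \<sigma>"
    using smooth by (simp only: smooth_on_def)
  then show "u \<in> N \<Longrightarrow> \<sigma> differentiable (at u)"
    "u \<in> N \<Longrightarrow> (\<lambda>x. frechet_derivative \<sigma> (at x) v) differentiable (at u)"
    by auto
qed

lemma Q_derivative: "u \<in> N \<Longrightarrow> (Q has_derivative (\<lambda>v. dQ v u)) (at u)"
  and D_derivative: "u \<in> N \<Longrightarrow> (D has_derivative (\<lambda>v. dD v u)) (at u)"
  unfolding Q_def D_def dQ_def dD_def
  by (auto intro!: has_derivative_fst has_derivative_snd differentiable_has_derivative diff_\<sigma>)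

lemma dQ_differentiable: "u \<in> N \<Longrightarrow> dQ v differentiable (at u)"
  and dD_differentiable: "u \<in> N \<Longrightarrow> dD v differentiable (at u)"
  using differentiable_linear[OF bounded_linear_fst diff_\<sigma>']
    differentiable_linear[OF bounded_linear_snd diff_\<sigma>']
  unfolding dQ_def dD_def by auto

lemma Q_differentiable: "u \<in> N \<Longrightarrow> Q differentiable (at u)"
  and D_differentiable: "u \<in> N \<Longrightarrow> D differentiable (at u)"
  using Q_derivative D_derivative unfolding differentiable_def by blast+

lemma F_derivative:
  assumes "u \<in> N" shows "(F has_derivative (\<lambda>v. dF v u)) (at u)"
proof -
  note mult = bounded_bilinear.FDERIV[OF bounded_bilinear_matrix_mult]
  have "((\<lambda>u. (Q u ** D u) ** transpose (Q u)) has_derivative (\<lambda>v. (Q u ** D u) ** transpose (dQ v u)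
      + (Q u ** dD v u + dQ v u ** D u) ** transpose (Q u))) (at u)"
    by (intro mult bounded_linear.has_derivative[OF bounded_linear_transpose]
        Q_derivative D_derivative assms)
  then show ?thesis
    by (simp add: F_def[abs_def] dF_def matrix_mult_simps algebra_simps)
qed

lemma F_differentiable: "u \<in> N \<Longrightarrow> F differentiable (at u)"
  using F_derivative unfolding differentiable_def by blast

lemma partial_F: "u \<in> N \<Longrightarrow> partial i F u = dF (axis i 1) u"
  unfolding partial_def by (rule frechet_derivative_eq[OF F_derivative])

lemma dF_eq_sum: "u \<in> N \<Longrightarrow> dF v u = (\<Sum>i\<in>UNIV. v $ i *\<^sub>R dF (axis i 1) u)"
  using frechet_derivative_eq_partials[OF F_differentiable, of u v]
    frechet_derivative_eq[OF F_derivative, of u v] by (simp add: partial_F)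

lemma dF_differentiable: "u \<in> N \<Longrightarrow> dF v differentiable (at u)"
  unfolding dF_def[abs_def]
  by (intro differentiable_add differentiable_matrix_mult differentiable_transpose
      Q_differentiable D_differentiable dQ_differentiable dD_differentiable)

lemma dF_symmetric:
  assumes "u \<in> N"
  shows "frechet_derivative (dF v) (at u) w = frechet_derivative (dF w) (at u) v"
  by (rule second_derivative_symmetric[OF open_N assms F_derivative])
    (auto intro!: differentiable_has_derivative dF_differentiable assms)

lemma r_simps:
  assumes "u \<in> N"
  shows "transpose (r u) = r u" "r u ** Q u = 0" "transpose (Q u) ** r u = 0"
    "X ** r u ** Q u = 0" "Y ** transpose (Q u) ** r u = 0"
proof -
  note cancel = stiefel_cancel[OF stiefel_Q[OF assms]]
  show *: "transpose (r u) = r u" "r u ** Q u = 0" "transpose (Q u) ** r u = 0"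
    by (simp_all add: r_def transpose_simps matrix_mult_simps matrix_mul_assoc cancel)
  show "X ** r u ** Q u = 0" "Y ** transpose (Q u) ** r u = 0"
    by (simp_all add: * matrix_mult_simps flip: matrix_mul_assoc)
qed

lemma transpose_dD: "u \<in> N \<Longrightarrow> transpose (dD v u) = dD v u"
proof -
  assume u: "u \<in> N"
  have "((\<lambda>u. transpose (D u)) has_derivative (\<lambda>v. transpose (dD v u))) (at u)"
    by (intro bounded_linear.has_derivative[OF bounded_linear_transpose] D_derivative u)
  then have "(D has_derivative (\<lambda>v. transpose (dD v u))) (at u)"
    using has_derivative_transform_on[OF _ open_N u] sym_posD(1)[OF sym_pos_D] by blast
  then show ?thesis
    using has_derivative_unique[OF _ D_derivative[OF u]] by metis
qed

lemma skew_QdQ: "u \<in> N \<Longrightarrow> transpose (dQ v u) ** Q u = - (transpose (Q u) ** dQ v u)"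
proof -
  assume u: "u \<in> N"
  have "((\<lambda>u. transpose (Q u) ** Q u) has_derivative
      (\<lambda>v. transpose (Q u) ** dQ v u + transpose (dQ v u) ** Q u)) (at u)"
    by (intro bounded_bilinear.FDERIV[OF bounded_bilinear_matrix_mult]
        bounded_linear.has_derivative[OF bounded_linear_transpose] Q_derivative u)
  then have "((\<lambda>u. mat 1) has_derivative
      (\<lambda>v. transpose (Q u) ** dQ v u + transpose (dQ v u) ** Q u)) (at u)"
    by (rule has_derivative_transform_on[OF _ open_N u])
      (rule stiefel_cancel(1)[OF stiefel_Q])
  then have "(\<lambda>v. transpose (Q u) ** dQ v u + transpose (dQ v u) ** Q u) = (\<lambda>v. 0)"
    by (rule has_derivative_unique) simp
  from fun_cong[OF this, of v] show ?thesis
    by (simp add: eq_neg_iff_add_eq_0 add.commute)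
qed

lemma transpose_dF: "u \<in> N \<Longrightarrow> transpose (dF v u) = dF v u"
  using sym_posD(1)[OF sym_pos_D] transpose_dD
  by (simp add: dF_def transpose_simps matrix_mul_assoc)

lemma dF_tangent: "u \<in> N \<Longrightarrow> dF v u \<in> tangent (Q u)"
  using transpose_dF r_simps
  by (simp add: tangent_def flip: r_def)
    (simp add: dF_def matrix_mult_simps matrix_mul_assoc)

text \<open>The kernel of the derivative of \<open>(Q, D) \<mapsto> Q D Q\<^sup>T\<close> is the vertical space: the mixed block of
  \<open>dF v = 0\<close> gives \<open>dQ v = Q A\<close> with \<open>A\<close> skew-symmetric, and the block on the range then
  determines \<open>dD v\<close>.\<close>

lemma dF_injective:
  assumes u: "u \<in> N" and zero: "dF v u = 0"
  shows "v = 0"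
proof (rule immersion[OF u])
  note cancel = stiefel_cancel[OF stiefel_Q[OF u]]
  define A where "A = transpose (Q u) ** dQ v u"
  obtain E where E: "D u ** E = mat 1"
    using sym_pos_inverse[OF sym_pos_D[OF u]] by metis
  have "r u ** dF v u ** Q u ** E = 0"
    by (simp add: zero matrix_mult_simps)
  also have "r u ** dF v u ** Q u ** E = r u ** dQ v u ** (D u ** E)"
    by (simp add: r_simps[OF u] dF_def matrix_mult_simps matrix_mul_assoc cancel)
  finally have "r u ** dQ v u = 0"
    by (simp add: E)
  then have dQ: "dQ v u = Q u ** A"
    by (simp add: r_def matrix_mult_simps A_def matrix_mul_assoc)
  have skew: "transpose A = - A"
    using skew_QdQ[OF u] by (simp add: A_def matrix_transpose_mul)
  have "0 = transpose (Q u) ** dF v u ** Q u"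
    by (simp add: zero matrix_mult_simps)
  also have "\<dots> = A ** D u + dD v u + D u ** transpose A"
    by (simp add: dF_def dQ matrix_mult_simps matrix_mul_assoc cancel matrix_transpose_mul)
  finally have "dD v u = D u ** A - A ** D u"
    by (simp add: skew matrix_mult_simps algebra_simps)
  then have "(dQ v u, dD v u) \<in> vertical (Q u, D u)"
    using dQ skew by (auto simp: vertical_def)
  then show "frechet_derivative \<sigma> (at u) v \<in> vertical (\<sigma> u)"
    by (simp add: dQ_def dD_def Q_def D_def)
qed

lemma range_dF: "u \<in> N \<Longrightarrow> range (\<lambda>v. dF v u) = tangent (Q u)"
proof -
  assume u: "u \<in> N"
  have lin: "linear (\<lambda>v. dF v u)"
    by (rule has_derivative_linear[OF F_derivative[OF u]])
  show ?thesis
    by (rule immersion_onto_tangent[OF stiefel_Q[OF u] lin])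
      (use dF_injective[OF u] dF_tangent[OF u] in \<open>auto simp: linear_injective_0[OF lin]\<close>)
qed

lemma transpose_S: "u \<in> N \<Longrightarrow> transpose (S v u) = S v u"
  using transpose_dF r_simps(1) transpose_sylvester[OF sym_pos_D]
  by (simp add: S_def transpose_simps matrix_mul_assoc add.commute add.left_commute)

lemma S_solves:
  assumes u: "u \<in> N"
  shows "S v u ** F u + F u ** S v u = dF v u"
proof -
  note cancel = stiefel_cancel[OF stiefel_Q[OF u]]
  let ?C = "sylvester (D u) (transpose (Q u) ** dF v u ** Q u)"
  have "S v u ** F u + F u ** S v u = Q u ** (D u ** ?C + ?C ** D u) ** transpose (Q u)
      + r u ** dQ v u ** D u ** transpose (Q u) + Q u ** D u ** transpose (dQ v u) ** r u"
    by (simp add: r_simps[OF u] S_def F_def matrix_mult_simps matrix_mul_assoc cancel algebra_simps)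
  also have "\<dots> = Q u ** transpose (Q u) ** dF v u ** Q u ** transpose (Q u)
      + r u ** dQ v u ** D u ** transpose (Q u) + Q u ** D u ** transpose (dQ v u) ** r u"
    by (simp add: sylvester_solves[OF sym_posD(2)[OF sym_pos_D[OF u]]] matrix_mul_assoc)
  also have "\<dots> = dF v u"
    by (simp add: dF_def r_def matrix_mult_simps matrix_mul_assoc cancel algebra_simps)
  finally show ?thesis .
qed

lemma S_differentiable:
  assumes u: "u \<in> N"
  shows "S v differentiable (at u)"
  unfolding S_def[abs_def] r_def
  by (intro differentiable_add differentiable_diff differentiable_const differentiable_matrix_mult
      differentiable_transpose differentiable_sylvester_compose
      Q_differentiable D_differentiable dQ_differentiable dF_differentiable
      sym_posD(2)[OF sym_pos_D] u)

lemma bw_metric_dF: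
  "u \<in> N \<Longrightarrow> bw_metric TYPE('k) (F u) (dF v u) (dF w u) = S v u \<bullet> (F u ** S w u)"
  by (rule bw_metric_eq_inner[OF stiefel_Q sym_pos_D F_def transpose_S])
    (simp_all add: S_solves)

lemma linear_S:
  assumes u: "u \<in> N"
  shows "linear (\<lambda>v. S v u)"
proof -
  note Q = has_derivative_linear[OF Q_derivative[OF u]]
  note F = has_derivative_linear[OF F_derivative[OF u]]
  note C = linear_sylvester[OF sym_posD(2)[OF sym_pos_D[OF u]]]
  show ?thesis
    by (intro linearI)
      (simp_all add: S_def linear_add[OF Q] linear_add[OF F] linear_add[OF C] linear_cmul[OF Q]
        linear_cmul[OF F] linear_cmul[OF C] matrix_mult_simps transpose_simps algebra_simps)
qed

lemma S_eq_sum: "u \<in> N \<Longrightarrow> S v u = (\<Sum>i\<in>UNIV. v $ i *\<^sub>R S (axis i 1) u)"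
proof -
  assume u: "u \<in> N"
  have "v = (\<Sum>i\<in>UNIV. v $ i *\<^sub>R axis i 1)"
    using basis_expansion[of v] by (simp add: scalar_mult_eq_scaleR)
  then have "S v u = S (\<Sum>i\<in>UNIV. v $ i *\<^sub>R axis i 1) u"
    by simp
  also have "\<dots> = (\<Sum>i\<in>UNIV. v $ i *\<^sub>R S (axis i 1) u)"
    by (simp add: linear_sum[OF linear_S[OF u]] linear_cmul[OF linear_S[OF u]])
  finally show ?thesis .
qed

lemma transpose_F: "u \<in> N \<Longrightarrow> transpose (F u) = F u"
  using sym_posD(1)[OF sym_pos_D] by (simp add: F_def transpose_simps matrix_mul_assoc)

lemma S_inner_commute:
  assumes u: "u \<in> N"
  shows "S v u \<bullet> (F u ** S w u) = S w u \<bullet> (F u ** S v u)"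
proof -
  have "S v u \<bullet> (F u ** S w u) = (F u ** S v u) \<bullet> S w u"
    by (simp add: inner_matrix_mult_left transpose_F[OF u] inner_commute[of "S v u"])
  then show ?thesis
    by (simp add: inner_commute)
qed

end

text \<open>The coefficient matrix \<open>G\<close> is prescribed on \<open>N\<close> only, because a lift exists only locally.\<close>

locale bw_coordinates = immersed_lift N \<sigma>
  for N :: "(real^('n::finite, 'k::finite) coord) set" and \<sigma> :: "real^('n, 'k) coord \<Rightarrow> ('n, 'k) pairs" +
  fixes G :: "real^('n, 'k) coord \<Rightarrow> real^('n, 'k) coord^('n, 'k) coord"
  assumes G: "\<And>u. u \<in> N \<Longrightarrow>
    G u = (\<chi> i j. bw_metric TYPE('k) (F u) (partial i F u) (partial j F u))"
begin

lemma G_eq: "u \<in> N \<Longrightarrow> G u $ i $ j = S (axis i 1) u \<bullet> (F u ** S (axis j 1) u)"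
  by (simp add: G partial_F bw_metric_dF)

lemma G_quadratic:
  assumes u: "u \<in> N"
  shows "(\<Sum>i\<in>UNIV. \<Sum>j\<in>UNIV. G u $ i $ j * a $ i * a $ j) = S a u \<bullet> (F u ** S a u)"
  unfolding S_eq_sum[OF u, of a]
  by (simp add: G_eq[OF u] matrix_mult_simps inner_sum_left inner_sum_right sum_distrib_left mult_ac)
    (intro sum.cong refl arg_cong2[where f = "(*)"] S_inner_commute u)

lemma transpose_G: "u \<in> N \<Longrightarrow> transpose (G u) = G u"
  by (simp add: vec_eq_iff transpose_def G_eq S_inner_commute)

lemma invertible_G:
  assumes u: "u \<in> N"
  shows "invertible (G u)"
proof -
  have "a = 0" if a: "G u *v a = 0" for a
  proof -
    have "S a u \<bullet> (F u ** S a u) = a \<bullet> (G u *v a)"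
      unfolding G_quadratic[OF u, symmetric]
      by (simp add: inner_vec_def matrix_vector_mult_def sum_distrib_left mult_ac)
    then have "S a u ** F u = 0 \<and> F u ** S a u = 0"
      using a by (intro inner_sandwich_pos_definite(2)[OF sym_pos_D[OF u] F_def transpose_S[OF u]]) simp
    then show "a = 0"
      using S_solves[OF u, of a] dF_injective[OF u] by simp
  qed
  then show ?thesis
    unfolding invertible_left_inverse using matrix_left_invertible_ker by blast
qed

lemma G_differentiable:
  assumes u: "u \<in> N"
  shows "(\<lambda>u. G u $ i $ j) differentiable (at u)"
proof -
  have "(\<lambda>u. S (axis i 1) u \<bullet> (F u ** S (axis j 1) u)) differentiable (at u)"
    by (intro differentiable_inner_prod differentiable_matrix_mult S_differentiable F_differentiable u)
  then obtain g where "((\<lambda>u. S (axis i 1) u \<bullet> (F u ** S (axis j 1) u)) has_derivative g) (at u)"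
    unfolding differentiable_def by blast
  then have "((\<lambda>u. G u $ i $ j) has_derivative g) (at u)"
    by (rule has_derivative_transform_on[OF _ open_N u]) (simp add: G_eq)
  then show ?thesis
    by (rule differentiableI)
qed

text \<open>Differentiating \<open>S F + F S = dF a\<close> in direction \<open>w\<close> and pairing with \<open>S\<close> expresses the derivative
  of \<open>S\<close> through the second derivative of \<open>F\<close>, whose symmetry allows the two directions to be
  exchanged.\<close>

lemma energy_derivative:
  assumes u: "u \<in> N"
  shows "((\<lambda>u. \<Sum>i\<in>UNIV. \<Sum>j\<in>UNIV. G u $ i $ j * a $ i * a $ j) has_derivative
      (\<lambda>w. 2 * (S a u \<bullet> (F u ** frechet_derivative (S a) (at u) w)) + S a u \<bullet> (dF w u ** S a u))) (at u)"
    and "2 * (S a u \<bullet> (F u ** frechet_derivative (S a) (at u) w)) + S a u \<bullet> (dF w u ** S a u)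
      = S a u \<bullet> frechet_derivative (dF w) (at u) a - (S a u ** S a u) \<bullet> dF w u"
proof -
  let ?H = "frechet_derivative (S a) (at u) w"
  note mult = bounded_bilinear.FDERIV[OF bounded_bilinear_matrix_mult]
  note dS = differentiable_has_derivative[OF S_differentiable[OF u]]
  have swap: "frechet_derivative (S a) (at u) w \<bullet> (F u ** S a u)
      = S a u \<bullet> (F u ** frechet_derivative (S a) (at u) w)" for w
    by (simp add: inner_matrix_mult_left[of "F u"] transpose_F[OF u] inner_commute[of "S a u"])
  have "((\<lambda>u. S a u \<bullet> (F u ** S a u)) has_derivative
      (\<lambda>w. S a u \<bullet> (F u ** frechet_derivative (S a) (at u) w + dF w u ** S a u)
        + frechet_derivative (S a) (at u) w \<bullet> (F u ** S a u))) (at u)"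
    by (intro bounded_bilinear.FDERIV[OF bounded_bilinear_inner] mult dS F_derivative u)
  then have "((\<lambda>u. S a u \<bullet> (F u ** S a u)) has_derivative
      (\<lambda>w. 2 * (S a u \<bullet> (F u ** frechet_derivative (S a) (at u) w)) + S a u \<bullet> (dF w u ** S a u))) (at u)"
    by (simp add: swap inner_add_right algebra_simps)
  then show "((\<lambda>u. \<Sum>i\<in>UNIV. \<Sum>j\<in>UNIV. G u $ i $ j * a $ i * a $ j) has_derivative
      (\<lambda>w. 2 * (S a u \<bullet> (F u ** frechet_derivative (S a) (at u) w)) + S a u \<bullet> (dF w u ** S a u))) (at u)"
    by (rule has_derivative_transform_on[OF _ open_N u]) (simp add: G_quadratic)
  have "((\<lambda>u. transpose (S a u)) has_derivative (\<lambda>w. transpose (frechet_derivative (S a) (at u) w))) (at u)"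
    by (rule bounded_linear.has_derivative[OF bounded_linear_transpose dS])
  then have "(S a has_derivative (\<lambda>w. transpose (frechet_derivative (S a) (at u) w))) (at u)"
    by (rule has_derivative_transform_on[OF _ open_N u]) (rule transpose_S)
  from fun_cong[OF has_derivative_unique[OF this dS], of w] have symH: "transpose ?H = ?H"
    by simp
  have "((\<lambda>u. S a u ** F u + F u ** S a u) has_derivative
      (\<lambda>w. (S a u ** dF w u + frechet_derivative (S a) (at u) w ** F u)
        + (F u ** frechet_derivative (S a) (at u) w + dF w u ** S a u))) (at u)"
    by (intro has_derivative_add mult dS F_derivative u)
  then have "(dF a has_derivative
      (\<lambda>w. (S a u ** dF w u + frechet_derivative (S a) (at u) w ** F u)
        + (F u ** frechet_derivative (S a) (at u) w + dF w u ** S a u))) (at u)"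
    by (rule has_derivative_transform_on[OF _ open_N u]) (rule S_solves)
  from frechet_derivative_eq[OF this, of w] dF_symmetric[OF u, of a w]
  have eq: "frechet_derivative (dF w) (at u) a
      = S a u ** dF w u + ?H ** F u + (F u ** ?H + dF w u ** S a u)"
    by simp
  have *: "S a u \<bullet> (S a u ** dF w u) = S a u \<bullet> (dF w u ** S a u)"
    using inner_transpose[of "S a u" "S a u ** dF w u"]
    by (simp add: matrix_transpose_mul transpose_S[OF u] transpose_dF[OF u])
  have **: "S a u \<bullet> (?H ** F u) = S a u \<bullet> (F u ** ?H)"
    using inner_transpose[of "S a u" "?H ** F u"]
    by (simp add: matrix_transpose_mul transpose_S[OF u] transpose_F[OF u] symH)
  have ***: "(S a u ** S a u) \<bullet> dF w u = S a u \<bullet> (dF w u ** S a u)"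
    by (simp add: inner_matrix_mult_right transpose_S[OF u])
  show "2 * (S a u \<bullet> (F u ** ?H)) + S a u \<bullet> (dF w u ** S a u)
      = S a u \<bullet> frechet_derivative (dF w) (at u) a - (S a u ** S a u) \<bullet> dF w u"
    by (simp add: eq inner_add_right * ** ***)
qed

end

locale bw_geodesic = bw_coordinates N \<sigma> G
  for N :: "(real^('n::finite, 'k::finite) coord) set" and \<sigma> :: "real^('n, 'k) coord \<Rightarrow> ('n, 'k) pairs"
    and G +
  fixes J :: "real set" and x x' :: "real \<Rightarrow> real^('n, 'k) coord"
  assumes open_J: "open J" and x_in: "\<And>s. s \<in> J \<Longrightarrow> x s \<in> N"
    and x: "\<And>s. s \<in> J \<Longrightarrow> (x has_vector_derivative x' s) (at s)"
    and x': "\<And>s. s \<in> J \<Longrightarrow> (x' has_vector_derivative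
      (\<chi> l. - (\<Sum>i\<in>UNIV. \<Sum>j\<in>UNIV. christoffel G (x s) l i j * x' s $ i * x' s $ j))) (at s)"
begin

text \<open>The symmetric lift of the velocity along the curve.\<close>

definition A where "A s = S (x' s) (x s)"

lemma transpose_A: "s \<in> J \<Longrightarrow> transpose (A s) = A s"
  by (simp add: A_def transpose_S x_in)

lemma A_solves: "s \<in> J \<Longrightarrow> A s ** F (x s) + F (x s) ** A s = dF (x' s) (x s)"
  by (simp add: A_def S_solves x_in)

lemma A_has_derivative:
  assumes s: "s \<in> J"
  obtains A' where "(A has_vector_derivative A') (at s)" "transpose A' = A'"
proof -
  have "((\<lambda>t. x' t $ i) has_real_derivative
      - (\<Sum>k\<in>UNIV. \<Sum>j\<in>UNIV. christoffel G (x s) i k j * x' s $ k * x' s $ j)) (at s)" for i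
    using bounded_linear.has_vector_derivative[OF bounded_linear_vec_nth x'[OF s]]
    by (simp add: has_real_derivative_iff_has_vector_derivative)
  note dx' = this
  have dS: "((\<lambda>t. S (axis i 1) (x t)) has_vector_derivative
      frechet_derivative (S (axis i 1)) (at (x s)) (x' s)) (at s)" for i
    by (rule has_vector_derivative_compose[OF
          differentiable_has_derivative[OF S_differentiable[OF x_in[OF s]]] x[OF s]])
  have "\<exists>A'. ((\<lambda>t. \<Sum>i\<in>UNIV. x' t $ i *\<^sub>R S (axis i 1) (x t)) has_vector_derivative A') (at s)"
    by (rule exI, rule has_vector_derivative_sum, rule has_vector_derivative_scaleR[OF dx' dS])
  then obtain A' where "((\<lambda>t. \<Sum>i\<in>UNIV. x' t $ i *\<^sub>R S (axis i 1) (x t)) has_vector_derivative A') (at s)"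
    by blast
  then have A': "(A has_vector_derivative A') (at s)"
    by (rule has_vector_derivative_transform_within_open[OF _ open_J s])
      (simp add: A_def flip: S_eq_sum[OF x_in])
  have "((\<lambda>t. transpose (A t)) has_vector_derivative transpose A') (at s)"
    by (rule bounded_linear.has_vector_derivative[OF bounded_linear_transpose A'])
  then have "(A has_vector_derivative transpose A') (at s)"
    by (rule has_vector_derivative_transform_within_open[OF _ open_J s]) (rule transpose_A)
  then have "transpose A' = A'"
    using A' by (rule vector_derivative_unique_at)
  with A' show thesis
    using that by blast
qed

text \<open>The momentum is \<open>p\<^sub>m = (1/2) A \<bullet> \<partial>\<^sub>m F\<close>.  Its derivative along the curve and the
  Euler--Lagrange equation both contain \<open>A \<bullet> \<partial>\<^sub>m \<partial>\<^sub>x\<^sub>' F\<close>, which cancels.\<close>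

lemma riccati:
  assumes s: "s \<in> J" and A': "(A has_vector_derivative A') (at s)" "transpose A' = A'"
  shows "(A' + A s ** A s) ** F (x s) = 0" and "F (x s) ** (A' + A s ** A s) = 0"
proof -
  let ?H = "A' + A s ** A s"
  note u = x_in[OF s]
  have orth: "?H \<bullet> dF (axis m 1) (x s) = 0" for m
  proof -
    let ?e = "axis m 1 :: real^('n, 'k) coord"
    have p: "(\<Sum>l\<in>UNIV. x' t $ l * G (x t) $ l $ m) = (1/2) * (A t \<bullet> dF ?e (x t))" if t: "t \<in> J" for t
    proof -
      note v = x_in[OF t]
      have "(\<Sum>l\<in>UNIV. x' t $ l * G (x t) $ l $ m) = A t \<bullet> (F (x t) ** S ?e (x t))"
        unfolding A_def S_eq_sum[OF v, of "x' t"] by (simp add: G_eq[OF v] inner_sum_left)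
      moreover have "A t \<bullet> (S ?e (x t) ** F (x t)) = A t \<bullet> (F (x t) ** S ?e (x t))"
        using inner_transpose[of "A t" "S ?e (x t) ** F (x t)"]
        by (simp add: matrix_transpose_mul transpose_A[OF t] transpose_F[OF v] transpose_S[OF v])
      ultimately show ?thesis
        by (simp add: inner_add_right flip: S_solves[OF v])
    qed
    have "((\<lambda>t. A t \<bullet> dF ?e (x t)) has_vector_derivative
        A s \<bullet> frechet_derivative (dF ?e) (at (x s)) (x' s) + A' \<bullet> dF ?e (x s)) (at s)"
      by (rule bounded_bilinear.has_vector_derivative[OF bounded_bilinear_inner A'(1)
            has_vector_derivative_compose[OF differentiable_has_derivative[OF dF_differentiable[OF u]] x[OF s]]])
    then have "((\<lambda>t. (1/2) * (A t \<bullet> dF ?e (x t))) has_vector_derivative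
        (1/2) * (A s \<bullet> frechet_derivative (dF ?e) (at (x s)) (x' s) + A' \<bullet> dF ?e (x s))) (at s)"
      by (rule has_vector_derivative_mult_right)
    then have p1: "((\<lambda>t. \<Sum>l\<in>UNIV. x' t $ l * G (x t) $ l $ m) has_vector_derivative
        (1/2) * (A s \<bullet> frechet_derivative (dF ?e) (at (x s)) (x' s) + A' \<bullet> dF ?e (x s))) (at s)"
      by (rule has_vector_derivative_transform_within_open[OF _ open_J s]) (simp add: p)
    have p2: "((\<lambda>t. \<Sum>l\<in>UNIV. x' t $ l * G (x t) $ l $ m) has_vector_derivative (1/2) *
        (\<Sum>i\<in>UNIV. \<Sum>j\<in>UNIV. partial m (\<lambda>u. G u $ i $ j) (x s) * x' s $ i * x' s $ j)) (at s)"
      by (rule euler_lagrange[OF x[OF s] x'[OF s] G_differentiable[OF u] transpose_G[OF u] invertible_G[OF u]])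
    have "((\<lambda>u. \<Sum>i\<in>UNIV. \<Sum>j\<in>UNIV. G u $ i $ j * x' s $ i * x' s $ j) has_derivative
        (\<lambda>w. \<Sum>i\<in>UNIV. \<Sum>j\<in>UNIV. frechet_derivative (\<lambda>u. G u $ i $ j) (at (x s)) w * x' s $ i * x' s $ j)) (at (x s))"
      by (intro has_derivative_sum has_derivative_mult_left
          differentiable_has_derivative G_differentiable u)
    from fun_cong[OF has_derivative_unique[OF this energy_derivative(1)[OF u]], of ?e]
    have energy: "(\<Sum>i\<in>UNIV. \<Sum>j\<in>UNIV. partial m (\<lambda>u. G u $ i $ j) (x s) * x' s $ i * x' s $ j)
        = A s \<bullet> frechet_derivative (dF ?e) (at (x s)) (x' s) - (A s ** A s) \<bullet> dF ?e (x s)"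
      unfolding energy_derivative(2)[OF u] by (simp add: partial_def A_def)
    have cancel: "b + c = 0" if "(1/2) * (a + b) = (1/2) * (a - c)" for a b c :: real
      using that by simp
    show ?thesis
      unfolding inner_add_left
      by (rule cancel[OF vector_derivative_unique_at[OF p1 p2[unfolded energy]]])
  qed
  have "?H \<bullet> V = 0" if V: "V \<in> tangent (Q (x s))" for V
  proof -
    obtain v where "V = dF v (x s)"
      using V unfolding range_dF[OF u, symmetric] by blast
    then have "V = (\<Sum>i\<in>UNIV. v $ i *\<^sub>R dF (axis i 1) (x s))"
      using dF_eq_sum[OF u] by metis
    then show ?thesis
      using orth by (simp add: inner_sum_right)
  qed
  moreover have "transpose ?H = ?H"
    using A'(2) transpose_A[OF s] by (simp add: transpose_simps)
  ultimately show "?H ** F (x s) = 0" "F (x s) ** ?H = 0"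
    using orthogonal_tangent_imp[OF stiefel_Q[OF u] sym_pos_D[OF u] F_def] by blast+
qed

text \<open>By \<open>riccati\<close> the products \<open>A' F\<close> and \<open>F A'\<close> equal \<open>- A\<^sup>2 F\<close> and \<open>- F A\<^sup>2\<close>, which removes \<open>A'\<close>
  from both derivatives.\<close>

lemma curve_derivatives:
  assumes s: "s \<in> J"
  shows "((\<lambda>s. F (x s)) has_vector_derivative dF (x' s) (x s)) (at s)"
    and "((\<lambda>s. dF (x' s) (x s)) has_vector_derivative 2 *\<^sub>R (A s ** F (x s) ** A s)) (at s)"
    and "((\<lambda>s. A s ** F (x s) ** A s) has_vector_derivative 0) (at s)"
proof -
  note mult = bounded_bilinear.has_vector_derivative[OF bounded_bilinear_matrix_mult]
  obtain A' where A': "(A has_vector_derivative A') (at s)" "transpose A' = A'"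
    using A_has_derivative[OF s] by blast
  have ric: "A' ** F (x s) = - (A s ** A s ** F (x s))" "F (x s) ** A' = - (F (x s) ** A s ** A s)"
    using riccati[OF s A'] by (simp_all add: matrix_mult_simps eq_neg_iff_add_eq_0 matrix_mul_assoc)
  show F: "((\<lambda>s. F (x s)) has_vector_derivative dF (x' s) (x s)) (at s)"
    by (rule has_vector_derivative_compose[OF F_derivative[OF x_in[OF s]] x[OF s]])
  have "((\<lambda>s. A s ** F (x s) + F (x s) ** A s) has_vector_derivative
      (A s ** dF (x' s) (x s) + A' ** F (x s)) + (F (x s) ** A' + dF (x' s) (x s) ** A s)) (at s)"
    by (intro has_vector_derivative_add mult A' F)
  also have "(A s ** dF (x' s) (x s) + A' ** F (x s)) + (F (x s) ** A' + dF (x' s) (x s) ** A s)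
      = 2 *\<^sub>R (A s ** F (x s) ** A s)"
    by (simp add: ric matrix_mult_simps matrix_mul_assoc scaleR_2 flip: A_solves[OF s])
  finally show "((\<lambda>s. dF (x' s) (x s)) has_vector_derivative 2 *\<^sub>R (A s ** F (x s) ** A s)) (at s)"
    by (rule has_vector_derivative_transform_within_open[OF _ open_J s]) (rule A_solves)
  have "((\<lambda>s. A s ** F (x s) ** A s) has_vector_derivative
      A s ** F (x s) ** A' + (A s ** dF (x' s) (x s) + A' ** F (x s)) ** A s) (at s)"
    by (intro mult A' F)
  also have "A s ** F (x s) ** A' + (A s ** dF (x' s) (x s) + A' ** F (x s)) ** A s
      = A s ** (F (x s) ** A') + (A s ** dF (x' s) (x s) + A' ** F (x s)) ** A s"
    by (simp add: matrix_mul_assoc)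
  also have "\<dots> = 0"
    by (simp add: ric matrix_mult_simps matrix_mul_assoc flip: A_solves[OF s])
  finally show "((\<lambda>s. A s ** F (x s) ** A s) has_vector_derivative 0) (at s)" .
qed

end

section \<open>The quotient manifold and its fibers\<close>

lemma mem_quot_class:
  assumes "Q \<in> stiefel" "D \<in> sym_pos"
  shows "(Q, D) \<in> quot_class (Q, D)"
proof -
  have "\<exists>G. orthogonal_matrix G \<and> Q = Q ** G \<and> D = transpose G ** D ** G"
    by (rule exI[of _ "mat 1"]) (simp add: orthogonal_matrix_id)
  then show ?thesis
    using assms by (simp add: quot_class_def orbit_rel_def)
qed

lemma the_elem_image_constant:
  assumes "x \<in> S" "\<And>p. p \<in> S \<Longrightarrow> f p = c"
  shows "the_elem (f ` S) = c"
proof -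
  have "f ` S = {c}"
    using assms by auto
  then show ?thesis
    by simp
qed

lemma phi_quot_class:
  assumes "Q \<in> stiefel" "D \<in> sym_pos"
  shows "phi (quot_class (Q, D)) = Q ** D ** transpose Q"
proof -
  have const: "(\<lambda>(Q, D). Q ** D ** transpose Q) p = Q ** D ** transpose Q"
    if mem: "p \<in> quot_class (Q, D)" for p
  proof -
    obtain G where G: "orthogonal_matrix G" and p: "p = (Q ** G, transpose G ** D ** G)"
      using mem by (auto simp: quot_class_def orbit_rel_def)
    have cancel: "X ** G ** transpose G = X" for X :: "real^'a^'b"
      using G by (simp add: orthogonal_matrix_def flip: matrix_mul_assoc)
    show ?thesis
      by (simp add: p matrix_transpose_mul matrix_mul_assoc cancel)
  qed
  show ?thesis
    unfolding phi_def
    by (rule the_elem_image_constant[OF mem_quot_class[OF assms] const])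
qed

lemma span_columns_mult_subset: "span (columns (Q ** G)) \<subseteq> span (columns Q)"
  for Q :: "real^'m^'n" and G :: "real^'l^'m"
proof (rule span_minimal)
  have "column j (Q ** G) = Q *v column j G" for j
    by (simp add: column_def matrix_matrix_mult_def matrix_vector_mult_def vec_eq_iff)
  then show "columns (Q ** G) \<subseteq> span (columns Q)"
    using matrix_vector_mult_in_columnspace by (auto simp: columns_def)
qed simp

lemma pi_M_quot_class:
  assumes "Q \<in> stiefel" "D \<in> sym_pos"
  shows "pi_M (quot_class (Q, D)) = span (columns Q)"
proof -
  have const: "(\<lambda>(Q, D). span (columns Q)) p = span (columns Q)" if mem: "p \<in> quot_class (Q, D)" for p
  proof -
    obtain G where G: "orthogonal_matrix G" and p: "p = (Q ** G, transpose G ** D ** G)"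
      using mem by (auto simp: quot_class_def orbit_rel_def)
    have "Q = (Q ** G) ** transpose G"
      using G by (simp add: orthogonal_matrix_def flip: matrix_mul_assoc)
    then have "span (columns (Q ** G)) = span (columns Q)"
      using span_columns_mult_subset[of Q G] span_columns_mult_subset[of "Q ** G" "transpose G"]
      by auto
    then show ?thesis
      by (simp add: p)
  qed
  show ?thesis
    unfolding pi_M_def
    by (rule the_elem_image_constant[OF mem_quot_class[OF assms] const])
qed

text \<open>The kernel of \<open>phi m\<close> is the orthogonal complement of the columns of \<open>Q\<close>; since the dimensions
  agree, it contains the complement of \<open>P\<close> only if the columns span \<open>P\<close>.\<close>

lemma fiber_iff_annihilated:
  fixes m :: "('n::finite, 'k::finite) pairs set"
  assumes P: "P \<in> grassmannian CARD('k)" and m: "m \<in> quot_M"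
  shows "m \<in> fiber P \<longleftrightarrow> (\<forall>w\<in>P\<^sup>\<bottom>. phi m *v w = 0)"
proof -
  obtain Q D where Q: "Q \<in> stiefel" and D: "D \<in> sym_pos" and m_eq: "m = quot_class (Q, D)"
    using m by (auto simp: quot_M_def quot_class_def elim!: quotientE)
  have P': "subspace P" "dim P = CARD('k)"
    using P by (auto simp: grassmannian_def)
  obtain E where E: "E ** D = mat 1"
    using sym_pos_inverse[OF D] by metis
  have "E ** transpose Q ** (Q ** D ** transpose Q) = transpose Q"
    by (simp add: matrix_mul_assoc stiefel_cancel[OF Q] E)
  then have "(Q ** D ** transpose Q) *v w = 0 \<longleftrightarrow> transpose Q *v w = 0" for w
    by (metis matrix_vector_mul_assoc matrix_vector_mult_0_right)
  also have "transpose Q *v w = 0 \<longleftrightarrow> (\<forall>q\<in>columns Q. orthogonal w q)" for w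
  proof -
    have "(transpose Q *v w) $ i = w \<bullet> column i Q" for i
      unfolding matrix_vector_mul_component
      by (simp add: transpose_def column_def inner_commute)
    moreover have "columns Q = range (\<lambda>i. column i Q)"
      by (auto simp: columns_def)
    ultimately show ?thesis
      by (simp only: vec_eq_iff ball_simps orthogonal_def zero_index)
  qed
  finally have null: "phi m *v w = 0 \<longleftrightarrow> (\<forall>q\<in>columns Q. orthogonal w q)" for w
    by (simp add: m_eq phi_quot_class[OF Q D])
  have "(\<forall>w\<in>P\<^sup>\<bottom>. phi m *v w = 0) \<longleftrightarrow> columns Q \<subseteq> P\<^sup>\<bottom>\<^sup>\<bottom>"
    by (auto simp: null orthogonal_comp_def[of "P\<^sup>\<bottom>"])
  also have "\<dots> \<longleftrightarrow> columns Q \<subseteq> P"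
    by (simp add: orthogonal_comp_self[OF P'(1)])
  also have "\<dots> \<longleftrightarrow> span (columns Q) = P"
  proof
    assume "columns Q \<subseteq> P"
    then have "span (columns Q) \<subseteq> P"
      using P'(1) by (rule span_minimal)
    moreover have "dim (span (columns Q)) = CARD('k)"
      by (simp add: dim_eq_card_independent[OF stiefel_columns(2)[OF Q]] stiefel_columns(3)[OF Q])
    ultimately show "span (columns Q) = P"
      using P' by (intro subspace_dim_equal) auto
  qed (metis span_superset)
  finally show ?thesis
    using m by (simp add: fiber_def m_eq pi_M_quot_class[OF Q D])
qed

lemma parametrization_lift:
  fixes \<psi> :: "real^('n::finite, 'k::finite) coord \<Rightarrow> ('n, 'k) pairs set"
  assumes "(U, \<psi>) \<in> quot_params" "u \<in> U"
  obtains N \<sigma> where "bw_coordinates N \<sigma> (metric_h \<psi>)" "u \<in> N" "N \<subseteq> U"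
    "\<And>x. x \<in> N \<Longrightarrow> phi (\<psi> x) = immersed_lift.F \<sigma> x"
proof -
  have "\<forall>u\<in>U. \<exists>N \<sigma>. open N \<and> u \<in> N \<and> N \<subseteq> U \<and> smooth_on N \<sigma> \<and>
      \<sigma> ` N \<subseteq> stiefel \<times> sym_pos \<and> (\<forall>x\<in>N. \<psi> x = quot_class (\<sigma> x)) \<and>
      (\<forall>x\<in>N. \<forall>v. frechet_derivative \<sigma> (at x) v \<in> vertical (\<sigma> x) \<longrightarrow> v = 0)"
    using assms(1) unfolding quot_params_def mem_Collect_eq prod.case by (elim conjE)
  from bspec[OF this assms(2)]
  obtain N \<sigma> where N: "open N" "u \<in> N" "N \<subseteq> U" "smooth_on N \<sigma>" "\<sigma> ` N \<subseteq> stiefel \<times> sym_pos"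
    "\<forall>x\<in>N. \<psi> x = quot_class (\<sigma> x)"
    "\<forall>x\<in>N. \<forall>v. frechet_derivative \<sigma> (at x) v \<in> vertical (\<sigma> x) \<longrightarrow> v = 0"
    by (elim exE conjE) (rule that)
  interpret immersed_lift N \<sigma>
    by unfold_locales (use N in auto)
  have phi: "phi (\<psi> x) = F x" if "x \<in> N" for x
    using phi_quot_class[OF stiefel_Q[OF that] sym_pos_D[OF that]] N(6) that
    by (simp add: F_def Q_def D_def)
  have "partial i (phi \<circ> \<psi>) x = partial i F x" if x: "x \<in> N" for i x
    unfolding partial_def
    using frechet_derivative_transform_within_open[OF F_differentiable[OF x] open_N x, of "phi \<circ> \<psi>"]
    by (simp add: phi)
  then have "bw_coordinates N \<sigma> (metric_h \<psi>)"
    by unfold_locales (simp add: metric_h_def phi)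
  then show thesis
    using that N phi by blast
qed

lemma geodesic_locally_quadratic:
  fixes \<gamma> :: "real \<Rightarrow> ('n::finite, 'k::finite) pairs set"
  assumes "geodesic quot_params metric_h I \<gamma>" and "t \<in> I"
  obtains J V C where "open J" "t \<in> J"
    "\<And>s. s \<in> J \<Longrightarrow> \<gamma> s \<in> quot_M"
    "\<And>s. s \<in> J \<Longrightarrow> ((\<lambda>s. phi (\<gamma> s)) has_vector_derivative V s) (at s)"
    "\<And>s. s \<in> J \<Longrightarrow> (V has_vector_derivative 2 *\<^sub>R C s) (at s)"
    "\<And>s. s \<in> J \<Longrightarrow> (C has_vector_derivative 0) (at s)"
    "\<exists>A. V t = A ** phi (\<gamma> t) + phi (\<gamma> t) ** A \<and> C t = A ** phi (\<gamma> t) ** A"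
proof -
  let ?solution = "\<lambda>U \<psi> J x x'. \<forall>s\<in>J. x s \<in> U \<and> \<gamma> s = \<psi> (x s) \<and>
      (x has_vector_derivative x' s) (at s) \<and>
      (x' has_vector_derivative (\<chi> l. - (\<Sum>i\<in>UNIV. \<Sum>j\<in>UNIV.
        christoffel (metric_h \<psi>) (x s) l i j * x' s $ i * x' s $ j))) (at s)"
  have "\<exists>(U, \<psi>)\<in>quot_params. \<exists>J x x'. open J \<and> t \<in> J \<and> J \<subseteq> I \<and> ?solution U \<psi> J x x'"
    using assms unfolding geodesic_def by (elim conjE) (erule bspec)
  then obtain U \<psi> J0 x x' where U: "(U, \<psi>) \<in> quot_params" and J0: "open J0" "t \<in> J0"
    and sol: "?solution U \<psi> J0 x x'"
    by (elim bexE case_prodE exE conjE, hypsubst) (rule that)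
  have curve: "\<And>s. s \<in> J0 \<Longrightarrow> x s \<in> U \<and> \<gamma> s = \<psi> (x s)"
    and x: "\<And>s. s \<in> J0 \<Longrightarrow> (x has_vector_derivative x' s) (at s)"
    and x': "\<And>s. s \<in> J0 \<Longrightarrow> (x' has_vector_derivative (\<chi> l. - (\<Sum>i\<in>UNIV. \<Sum>j\<in>UNIV.
      christoffel (metric_h \<psi>) (x s) l i j * x' s $ i * x' s $ j))) (at s)"
    using sol by simp_all
  obtain N \<sigma> where N: "bw_coordinates N \<sigma> (metric_h \<psi>)" "x t \<in> N" "N \<subseteq> U"
    "\<And>x. x \<in> N \<Longrightarrow> phi (\<psi> x) = immersed_lift.F \<sigma> x"
    by (rule parametrization_lift[OF U conjunct1[OF curve[OF J0(2)]]]) (rule that)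
  interpret bw_coordinates N \<sigma> "metric_h \<psi>"
    by (rule N(1))
  define J where "J = J0 \<inter> x -` N"
  have "continuous_on J0 x"
    using x by (meson continuous_at_imp_continuous_on has_vector_derivative_continuous)
  then have J: "open J"
    unfolding J_def using J0(1) open_N by (rule continuous_open_preimage)
  interpret bw_geodesic N \<sigma> "metric_h \<psi>" J x x'
    by unfold_locales (use J x x' in \<open>auto simp: J_def\<close>)
  have tJ: "t \<in> J"
    using J0(2) N(2) by (simp add: J_def)
  have phi: "phi (\<gamma> s) = F (x s)" if "s \<in> J" for s
    using that curve N(4) by (simp add: J_def)
  show thesis
  proof
    show "open J" "t \<in> J"
      by (fact J tJ)+
    show "\<gamma> s \<in> quot_M" if "s \<in> J" for s
      using that curve[of s] U by (auto simp: J_def quot_params_def)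
    show "((\<lambda>s. phi (\<gamma> s)) has_vector_derivative dF (x' s) (x s)) (at s)" if "s \<in> J" for s
      by (rule has_vector_derivative_transform_within_open[OF curve_derivatives(1)[OF that] J that])
        (simp add: phi)
    show "((\<lambda>s. dF (x' s) (x s)) has_vector_derivative 2 *\<^sub>R (A s ** F (x s) ** A s)) (at s)"
      "((\<lambda>s. A s ** F (x s) ** A s) has_vector_derivative 0) (at s)" if "s \<in> J" for s
      by (fact curve_derivatives(2,3)[OF that])+
    show "\<exists>B. dF (x' t) (x t) = B ** phi (\<gamma> t) + phi (\<gamma> t) ** B \<and>
        A t ** F (x t) ** A t = B ** phi (\<gamma> t) ** B"
      by (rule exI[of _ "A t"]) (simp add: phi[OF tJ] A_solves[OF tJ])
  qed
qed

lemma vector_derivative_zero_imp_constant: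
  fixes f :: "real \<Rightarrow> 'a::real_normed_vector"
  assumes "is_interval I" "\<And>t. t \<in> I \<Longrightarrow> (f has_vector_derivative 0) (at t)" "s \<in> I" "t \<in> I"
  shows "f s = f t"
proof -
  have "convex I"
    using assms(1) by (simp add: is_interval_convex)
  moreover have "(f has_derivative (\<lambda>h. 0)) (at t within I)" if "t \<in> I" for t
    using assms(2)[OF that] by (auto simp: has_vector_derivative_def intro: has_derivative_at_withinI)
  ultimately obtain c where "\<forall>t\<in>I. f t = c"
    using has_derivative_zero_constant[of I f] by metis
  then show ?thesis
    using assms(3,4) by simp
qed

text \<open>The coefficients are recovered from the curve itself as \<open>V = \<Sigma>'\<close> and \<open>C = \<Sigma>'' / 2\<close>, so the
  local descriptions agree with each other, and \<open>C' = 0\<close> on the interval can be integrated twice.\<close>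

lemma geodesic_quadratic:
  fixes \<gamma> :: "real \<Rightarrow> ('n::finite, 'k::finite) pairs set"
  assumes geo: "geodesic quot_params metric_h I \<gamma>" and I0: "0 \<in> I"
  obtains V A where "((\<lambda>s. phi (\<gamma> s)) has_vector_derivative V) (at 0)"
    "V = A ** phi (\<gamma> 0) + phi (\<gamma> 0) ** A"
    "\<And>t. t \<in> I \<Longrightarrow> \<gamma> t \<in> quot_M"
    "\<And>t. t \<in> I \<Longrightarrow> phi (\<gamma> t) = phi (\<gamma> 0) + t *\<^sub>R V + t\<^sup>2 *\<^sub>R (A ** phi (\<gamma> 0) ** A)"
proof -
  have I: "is_interval I"
    using geo by (simp add: geodesic_def)
  define \<Sigma> where "\<Sigma> = (\<lambda>s. phi (\<gamma> s))"
  define V where "V s = vector_derivative \<Sigma> (at s)" for s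
  define C where "C s = (1/2) *\<^sub>R vector_derivative V (at s)" for s
  have *: "\<gamma> t \<in> quot_M \<and> (\<Sigma> has_vector_derivative V t) (at t) \<and>
      (V has_vector_derivative 2 *\<^sub>R C t) (at t) \<and> (C has_vector_derivative 0) (at t) \<and>
      (\<exists>A. V t = A ** \<Sigma> t + \<Sigma> t ** A \<and> C t = A ** \<Sigma> t ** A)" if t: "t \<in> I" for t
  proof -
    obtain J W K where J: "open J" "t \<in> J" "\<And>s. s \<in> J \<Longrightarrow> \<gamma> s \<in> quot_M"
      and W: "\<And>s. s \<in> J \<Longrightarrow> (\<Sigma> has_vector_derivative W s) (at s)"
      and K: "\<And>s. s \<in> J \<Longrightarrow> (W has_vector_derivative 2 *\<^sub>R K s) (at s)"
      "\<And>s. s \<in> J \<Longrightarrow> (K has_vector_derivative 0) (at s)"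
      and A: "\<exists>A. W t = A ** \<Sigma> t + \<Sigma> t ** A \<and> K t = A ** \<Sigma> t ** A"
      using geodesic_locally_quadratic[OF geo t] unfolding \<Sigma>_def by blast
    have V: "V s = W s" if "s \<in> J" for s
      unfolding V_def by (rule vector_derivative_at[OF W[OF that]])
    have V': "(V has_vector_derivative 2 *\<^sub>R K s) (at s)" if "s \<in> J" for s
      by (rule has_vector_derivative_transform_within_open[OF K(1)[OF that] J(1) that]) (simp add: V)
    have C: "C s = K s" if "s \<in> J" for s
      unfolding C_def using vector_derivative_at[OF V'[OF that]] by simp
    have "(C has_vector_derivative 0) (at t)"
      by (rule has_vector_derivative_transform_within_open[OF K(2)[OF J(2)] J(1,2)]) (simp add: C)
    then show ?thesis
      using J(2,3) W V V' C A by simp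
  qed
  have C: "C t = C 0" if "t \<in> I" for t
    by (rule vector_derivative_zero_imp_constant[OF I _ that I0]) (use * in blast)
  have V: "V t = V 0 + (2 * t) *\<^sub>R C 0" if "t \<in> I" for t
  proof -
    have "((\<lambda>s. V s - (2 * s) *\<^sub>R C 0) has_vector_derivative 2 *\<^sub>R C s - 2 *\<^sub>R C 0) (at s)"
      if "s \<in> I" for s
      using * that by (auto intro!: derivative_eq_intros)
    then have "V t - (2 * t) *\<^sub>R C 0 = V 0 - (2 * 0) *\<^sub>R C 0"
      by (intro vector_derivative_zero_imp_constant[OF I _ that I0]) (use C in force)
    then show ?thesis
      by (simp add: algebra_simps)
  qed
  have "\<Sigma> t = \<Sigma> 0 + t *\<^sub>R V 0 + t\<^sup>2 *\<^sub>R C 0" if "t \<in> I" for t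
  proof -
    have "((\<lambda>s. \<Sigma> s - s *\<^sub>R V 0 - s\<^sup>2 *\<^sub>R C 0) has_vector_derivative V s - V 0 - (2 * s) *\<^sub>R C 0) (at s)"
      if "s \<in> I" for s
      using * that by (auto intro!: derivative_eq_intros)
    then have "\<Sigma> t - t *\<^sub>R V 0 - t\<^sup>2 *\<^sub>R C 0 = \<Sigma> 0 - 0 *\<^sub>R V 0 - 0\<^sup>2 *\<^sub>R C 0"
      by (intro vector_derivative_zero_imp_constant[OF I _ that I0]) (use V in force)
    then show ?thesis
      by (simp add: algebra_simps)
  qed
  then show thesis
    using that * I0 unfolding \<Sigma>_def by metis
qed

lemma eventually_in_chart:
  fixes x :: "real \<Rightarrow> 'a::real_normed_vector"
  assumes "(x has_vector_derivative y) (at 0)" "open N" "x 0 \<in> N" "open J" "0 \<in> J"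
  obtains d where "0 < d" "\<And>s. dist s 0 < d \<Longrightarrow> s \<in> J \<and> x s \<in> N"
proof -
  have "isCont x 0"
    using assms(1) by (rule has_vector_derivative_continuous)
  then obtain T where "open T" "0 \<in> T" "\<forall>s\<in>T. x s \<in> N"
    using assms(2,3) unfolding continuous_at_open by blast
  then have "eventually (\<lambda>s. x s \<in> N) (nhds 0)"
    unfolding eventually_nhds by blast
  moreover have "eventually (\<lambda>s. s \<in> J) (nhds 0)"
    using assms(4,5) by (rule eventually_nhds_in_open)
  ultimately have "eventually (\<lambda>s. s \<in> J \<and> x s \<in> N) (nhds 0)"
    by eventually_elim simp
  then show thesis
    using that unfolding eventually_nhds_metric by blast
qed

text \<open>Such a velocity is also the velocity of a curve inside the fiber, along which
  \<open>phi (\<psi> (c s)) w\<close> vanishes identically.\<close>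

lemma tangent_velocity_annihilated:
  fixes \<gamma> :: "real \<Rightarrow> ('n::finite, 'k::finite) pairs set"
  assumes P: "P \<in> grassmannian CARD('k)"
    and tangent: "initial_velocity_tangent quot_params (fiber P) \<gamma>"
    and V: "((\<lambda>s. phi (\<gamma> s)) has_vector_derivative V) (at 0)" and w: "w \<in> P\<^sup>\<bottom>"
  shows "V *v w = 0"
proof -
  obtain U \<psi> J x y where U: "(U, \<psi>) \<in> quot_params" and J: "open J" "0 \<in> J"
    and curve: "\<And>s. s \<in> J \<Longrightarrow> x s \<in> U \<and> \<gamma> s = \<psi> (x s)"
    and y: "y \<in> coord_tangent_space (U, \<psi>) (fiber P) (x 0)"
    and x: "(x has_vector_derivative y) (at 0)"
    using tangent unfolding initial_velocity_tangent_def by blast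
  obtain K c where K: "open K" "0 \<in> K"
    and c_fiber: "\<forall>s\<in>K. c s \<in> U \<and> \<psi> (c s) \<in> fiber P" and c: "c 0 = x 0"
    and c': "(c has_vector_derivative y) (at (0::real))"
    using y unfolding coord_tangent_space_def prod.case mem_Collect_eq
    by (elim exE conjE) (rule that)
  obtain N \<sigma> where N: "bw_coordinates N \<sigma> (metric_h \<psi>)" "x 0 \<in> N"
    "\<And>x. x \<in> N \<Longrightarrow> phi (\<psi> x) = immersed_lift.F \<sigma> x"
    by (rule parametrization_lift[OF U conjunct1[OF curve[OF J(2)]]]) (rule that)
  interpret bw_coordinates N \<sigma> "metric_h \<psi>"
    by (rule N(1))
  obtain d where d: "0 < d" "\<And>s. dist s 0 < d \<Longrightarrow> s \<in> J \<and> x s \<in> N"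
    using eventually_in_chart[OF x open_N N(2) J] by blast
  have "((\<lambda>s. F (x s)) has_vector_derivative dF y (x 0)) (at 0)"
    by (rule has_vector_derivative_compose[OF F_derivative[OF N(2)] x])
  then have "((\<lambda>s. phi (\<gamma> s)) has_vector_derivative dF y (x 0)) (at 0)"
    by (rule has_vector_derivative_transform_within[OF _ d(1)]) (use d(2) curve N(3) in auto)
  then have V_eq: "V = dF y (x 0)"
    using V vector_derivative_unique_at by blast
  have c0: "c 0 \<in> N"
    using N(2) c by simp
  obtain e where e: "0 < e" "\<And>s. dist s 0 < e \<Longrightarrow> s \<in> K \<and> c s \<in> N"
    using eventually_in_chart[OF c' open_N c0 K] by blast
  have F0: "F (c s) *v w = 0" if "dist s 0 < e" for s
  proof -
    have s: "s \<in> K" "c s \<in> N"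
      using e(2)[OF that] by auto
    then have "\<psi> (c s) \<in> fiber P"
      using c_fiber by blast
    then have "phi (\<psi> (c s)) *v w = 0"
      using fiber_iff_annihilated[OF P] w by (auto simp: fiber_def)
    then show ?thesis
      using N(3)[OF s(2)] by simp
  qed
  have "((\<lambda>s. F (c s)) has_vector_derivative dF y (c 0)) (at 0)"
    by (rule has_vector_derivative_compose[OF F_derivative[OF c0] c'])
  then have "((\<lambda>s. F (c s) *v w) has_vector_derivative dF y (c 0) *v w) (at 0)"
    by (rule bounded_linear.has_vector_derivative[OF
          bounded_bilinear.bounded_linear_left[OF bounded_bilinear_matrix_vector_mult]])
  moreover have "((\<lambda>s. F (c s) *v w) has_vector_derivative 0) (at 0)"
    by (rule has_vector_derivative_transform_within[OF has_vector_derivative_const e(1)])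
      (use F0 in auto)
  ultimately show ?thesis
    using vector_derivative_unique_at c V_eq by metis
qed

theorem corollary1:
  fixes P :: "(real^'n) set"
  assumes "P \<in> grassmannian CARD('k::finite)"
  shows "totally_geodesic quot_params metric_h (fiber P :: ('n, 'k) pairs set set)"
  unfolding totally_geodesic_def
proof (intro allI impI ballI, elim conjE)
  fix I :: "real set" and \<gamma> :: "real \<Rightarrow> ('n, 'k) pairs set" and t :: real
  assume geo: "geodesic quot_params metric_h I \<gamma>" and I0: "0 \<in> I" and start: "\<gamma> 0 \<in> fiber P"
    and tangent: "initial_velocity_tangent quot_params (fiber P) \<gamma>" and t: "t \<in> I"
  obtain V A where V: "((\<lambda>s. phi (\<gamma> s)) has_vector_derivative V) (at 0)"
    and A: "V = A ** phi (\<gamma> 0) + phi (\<gamma> 0) ** A"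
    and M: "\<And>t. t \<in> I \<Longrightarrow> \<gamma> t \<in> quot_M"
    and quadratic: "\<And>t. t \<in> I \<Longrightarrow> phi (\<gamma> t) = phi (\<gamma> 0) + t *\<^sub>R V + t\<^sup>2 *\<^sub>R (A ** phi (\<gamma> 0) ** A)"
    using geodesic_quadratic[OF geo I0] by blast
  have "phi (\<gamma> t) *v w = 0" if w: "w \<in> P\<^sup>\<bottom>" for w
  proof -
    have \<Sigma>w: "phi (\<gamma> 0) *v w = 0"
      using fiber_iff_annihilated[OF assms M[OF I0]] start w by blast
    have Vw: "V *v w = 0"
      by (rule tangent_velocity_annihilated[OF assms tangent V w])
    have "phi (\<gamma> 0) *v (A *v w) = V *v w - A *v (phi (\<gamma> 0) *v w)"
      by (simp add: A matrix_vector_mult_add_rdistrib matrix_vector_mul_assoc)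
    then have "(A ** phi (\<gamma> 0) ** A) *v w = 0"
      by (simp add: \<Sigma>w Vw flip: matrix_vector_mul_assoc)
    then show ?thesis
      by (simp add: quadratic[OF t] matrix_vector_mult_add_rdistrib \<Sigma>w Vw
          flip: scaleR_matrix_vector_assoc)
  qed
  then show "\<gamma> t \<in> fiber P"
    using fiber_iff_annihilated[OF assms M[OF t]] by blast
qed

end
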